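(* Let $a$ and $b$ be positive real numbers. Define functions $Q$ and $q$ on $\mathbb{R}$ by $$Q(t)=\frac{F\left(a,b;a+b;\frac{e^t}{1+e^t}\right)}{F\left(a,b;a+b;\frac{1}{1+e^t}\right)}\quad\text{and}\quad q(t)=\log Q(t).$$ Then the following hold: (1) $Q$ is a strictly increasing positive function on $\mathbb{R}$ with $Q(t)Q(-t)=1$ and $Q(t)=B(a,b)^{-1}[t+R(a,b)]+O(te^{-t})$ as $t\to+\infty$. (2) $q$ is a strictly increasing odd function on $\mathbb{R}$ satisfying $q(t)=\log t-\log B(a,b)+O(1/t)$ as $t\to+\infty$. (3) $q'$ is strictly increasing on $(-\infty,0]$ and strictly decreasing on $[0,\infty)$, so that $q$ is strictly convex on $(-\infty,0)$ and strictly concave on $(0,\infty)$. (4) $q(t)/t$ is strictly decreasing on $(0,\infty)$ and hence $q$ is subadditive on $(0,\infty)$, that is, $q(t+t')\le q(t)+q(t')$ for $t,t'>0$. (5) If $a+b\ge1$, then $Q(t)-t/B(a,b)$ is strictly decreasing and strictly convex on $(0,\infty)$. (6) If $a+b\ge1$, then $(R(a,b)+t)/B(a,b)<Q(t)<1+t/B(a,b)$ for all $t\in(0,\infty)$.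
   Context: $F(a,b;c;x)=\sum_{n=0}^\infty \frac{(a,n)(b,n)}{(c,n)}\frac{x^n}{n!}$ for $|x|<1$ is the Gaussian hypergeometric function, where $(a,0)=1$ and $(a,n)=a(a+1)\cdots(a+n-1)$ for $n\ge1$. $B(a,b)=\Gamma(a)\Gamma(b)/\Gamma(a+b)$ is the beta function, and $R(a,b)=-2\gamma-\Psi(a)-\Psi(b)$, where $\Psi=\Gamma'/\Gamma$ is the digamma function and $\gamma=-\Psi(1)$ is the Euler–Mascheroni constant. *)

theory Defs
  imports "HOL-Analysis.Analysis" "HOL-Library.Landau_Symbols"
begin

text \<open>The series is only meaningful for \<open>\<bar>x\<bar> < 1\<close> and \<open>c\<close> not a nonpositive integer.\<close>

definition hypergeo_F :: "real \<Rightarrow> real \<Rightarrow> real \<Rightarrow> real \<Rightarrow> real" where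
  "hypergeo_F a b c x =
     (\<Sum>n. pochhammer a n * pochhammer b n / pochhammer c n * (x ^ n / fact n))"

definition Ramanujan_R :: "real \<Rightarrow> real \<Rightarrow> real" where
  "Ramanujan_R a b = - 2 * euler_mascheroni - Digamma a - Digamma b"

definition strictly_convex_on :: "real set \<Rightarrow> (real \<Rightarrow> real) \<Rightarrow> bool" where
  "strictly_convex_on S f \<longleftrightarrow> convex S \<and>
     (\<forall>x\<in>S. \<forall>y\<in>S. \<forall>u v. x \<noteq> y \<longrightarrow> 0 < u \<longrightarrow> 0 < v \<longrightarrow> u + v = 1 \<longrightarrow>
        f (u * x + v * y) < u * f x + v * f y)"

definition strictly_concave_on :: "real set \<Rightarrow> (real \<Rightarrow> real) \<Rightarrow> bool" where
  "strictly_concave_on S f \<longleftrightarrow> strictly_convex_on S (\<lambda>x. - f x)"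

end

theory Submission
  imports Defs "HOL-Real_Asymp.Real_Asymp"
begin

text \<open>
  Let \<open>F(x) = F(a, b; a + b; x)\<close> and \<open>x = e\<^sup>t / (1 + e\<^sup>t)\<close>, so that \<open>Q(t) = F(x) / F(1 - x)\<close> and
  \<open>dx/dt = x (1 - x)\<close>. Everything rests on the function \<open>P(x) = (1 - x) F'(x)\<close>. Because the third
  parameter is \<open>a + b\<close>, it is again a power series with positive coefficients, and
  \<open>F' = P / (1 - x)\<close>, \<open>x P' = a b F - (a + b) P\<close> is a first-order system.

  \<^item> \<^bold>\<open>Shape of\<close> \<open>q\<close>. One finds \<open>q'(t) = G(x) + G(1 - x)\<close> with \<open>G = x P / F\<close>. This is symmetric under
  \<open>x \<mapsto> 1 - x\<close> and decreases for \<open>x \<ge> 1/2\<close> as soon as \<open>G\<close> is strictly concave. The system shows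
  that \<open>x\<^sup>a\<^sup>+\<^sup>b\<^sup>+\<^sup>1 F\<^sup>2 G''\<close> vanishes at \<open>0\<close> and that its derivative is minus a square
  (\<open>weighted_G_deriv2_deriv\<close>), so \<open>G'' < 0\<close>. Convexity, concavity, the decrease of \<open>q(t) / t\<close> and
  subadditivity follow by general calculus.

  \<^item> \<^bold>\<open>Asymptotics.\<close> The coefficients of \<open>P\<close> telescope and sum to \<open>1 / B(a, b)\<close>, so \<open>P\<close> is continuous
  on \<open>[0, 1]\<close> with \<open>P(1) = 1 / B(a, b)\<close>. Integrating the system twice near \<open>1\<close> gives
  \<open>B(a, b) F(x) + ln (1 - x) \<rightarrow> \<rho>(a, b)\<close> with an explicit error (\<open>F_bounds\<close>). The constant is
  \<open>R(a, b)\<close>: it is symmetric, decreasing in each parameter, satisfies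
  \<open>\<rho>(a + 1, b) = \<rho>(a, b) - 1 / a\<close> and \<open>\<rho>(1, 1) = 0\<close>, and these properties leave only
  \<open>- \<Psi>(a) - \<Psi>(b) + 2 \<Psi>(1)\<close> (\<open>const_term_eq_Ramanujan_R\<close>).

  \<^item> \<^bold>\<open>Linear bounds.\<close> Here \<open>Q'(t) = (x P(x) F(1-x) + (1-x) P(1-x) F(x)) / F(1-x)\<^sup>2\<close>. The
  denominator decreases in \<open>x\<close>. The numerator is nondecreasing for \<open>x \<ge> 1/2\<close> when \<open>a + b \<ge> 1\<close>, as
  \<open>P / F\<close> decreases (\<open>P_over_F_strict_antimono\<close>, by the same weighting device as for \<open>G\<close>).
  Hence \<open>Q(t) - t / B(a, b)\<close> is strictly convex for \<open>t \<ge> 0\<close>. Its limit at infinity is the finite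
  number \<open>R(a, b) / B(a, b)\<close>, so it is strictly decreasing, and the two bounds are its values at the
  two ends.
\<close>

section \<open>Calculus\<close>

lemma strictly_convex_on_if_deriv_strict_mono:
  fixes f f' :: "real \<Rightarrow> real"
  assumes S: "is_interval S" and f: "\<And>x. x \<in> S \<Longrightarrow> (f has_real_derivative f' x) (at x)"
    and mono: "strict_mono_on S f'"
  shows "strictly_convex_on S f"
proof -
  have lt: "f (u * x + v * y) < u * f x + v * f y"
    if "x \<in> S" "y \<in> S" "x < y" "0 < u" "0 < v" "u + v = 1" for x y u v
  proof -
    define z where "z = u * x + v * y"
    have u: "u = 1 - v"
      using that by simp
    have zx: "z - x = v * (y - x)" and yz: "y - z = u * (y - x)"
      by (simp_all add: z_def u algebra_simps)
    have "z - x > 0" "y - z > 0"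
      unfolding zx yz using that by simp_all
    then have xz: "x < z" "z < y"
      by simp_all
    have S': "w \<in> S" if "x \<le> w" "w \<le> y" for w
      using that S \<open>x \<in> S\<close> \<open>y \<in> S\<close> by (meson mem_is_interval_1_I)
    obtain r where r: "x < r" "r < z" "f z - f x = (z - x) * f' r"
      using MVT2[OF xz(1), of f f'] f S' xz by (metis less_imp_le order.trans)
    obtain s where s: "z < s" "s < y" "f y - f z = (y - z) * f' s"
      using MVT2[OF xz(2), of f f'] f S' xz by (metis less_imp_le order.trans)
    have "f' r < f' s"
      using mono r s xz by (intro strict_mono_onD[OF mono] S') auto
    then have "u * v * (y - x) * f' r < u * v * (y - x) * f' s"
      using that by simp
    then have "u * (f z - f x) < v * (f y - f z)"
      unfolding r s zx yz by (simp add: mult_ac)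
    then have "f z < u * f x + v * f y"
      by (simp add: u algebra_simps)
    then show ?thesis
      by (simp add: z_def)
  qed
  show ?thesis
    unfolding strictly_convex_on_def
  proof (intro conjI ballI allI impI)
    show "convex S"
      using S by (simp add: is_interval_convex_1)
    fix x y u v :: real
    assume *: "x \<in> S" "y \<in> S" "x \<noteq> y" "0 < u" "0 < v" "u + v = 1"
    then show "f (u * x + v * y) < u * f x + v * f y"
      using lt[of x y u v] lt[of y x v u] by (cases "x < y") (auto simp: add.commute)
  qed
qed

lemma strictly_concave_on_if_deriv_strict_antimono:
  fixes f f' :: "real \<Rightarrow> real"
  assumes "is_interval S" "\<And>x. x \<in> S \<Longrightarrow> (f has_real_derivative f' x) (at x)" "strict_antimono_on S f'"
  shows "strictly_concave_on S f"
  unfolding strictly_concave_on_def using assms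
  by (intro strictly_convex_on_if_deriv_strict_mono[where f' = "\<lambda>x. - f' x"])
     (auto intro!: DERIV_minus simp: monotone_on_def)

lemma strictly_convex_onD:
  "strictly_convex_on S f \<Longrightarrow> x \<in> S \<Longrightarrow> y \<in> S \<Longrightarrow> x \<noteq> y \<Longrightarrow> 0 < u \<Longrightarrow> 0 < v \<Longrightarrow> u + v = 1 \<Longrightarrow>
    f (u * x + v * y) < u * f x + v * f y"
  unfolding strictly_convex_on_def by blast

lemma strictly_convex_on_subset:
  "strictly_convex_on S f \<Longrightarrow> convex T \<Longrightarrow> T \<subseteq> S \<Longrightarrow> strictly_convex_on T f"
  unfolding strictly_convex_on_def by blast

lemma strictly_concave_on_subset:
  "strictly_concave_on S f \<Longrightarrow> convex T \<Longrightarrow> T \<subseteq> S \<Longrightarrow> strictly_concave_on T f"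
  unfolding strictly_concave_on_def by (rule strictly_convex_on_subset)

text \<open>The quotient is the slope of the chord from the origin.\<close>

lemma strictly_concave_imp_ratio_strict_antimono:
  assumes f: "strictly_concave_on {0..} f" and "f 0 = 0"
  shows "strict_antimono_on {0<..} (\<lambda>t. f t / t)"
proof (rule monotone_onI)
  fix s t :: real
  assume st: "s \<in> {0<..}" "t \<in> {0<..}" "s < t"
  have "- f ((1 - s / t) * 0 + s / t * t) < (1 - s / t) * - f 0 + s / t * - f t"
    using f st unfolding strictly_concave_on_def by (intro strictly_convex_onD[of "{0..}"]) auto
  then have "s / t * f t < f s"
    using st assms by simp
  then show "f t / t < f s / s"
    using st by (simp add: field_simps)
qed

text \<open>Both \<open>f s\<close> and \<open>f t\<close> are at least the respective share of \<open>f (s + t)\<close>, split in the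
  proportion \<open>s : t\<close>.\<close>

lemma ratio_antimono_imp_subadditive:
  fixes f :: "real \<Rightarrow> real"
  assumes f: "strict_antimono_on {0<..} (\<lambda>t. f t / t)" and st: "0 < s" "0 < t"
  shows "f (s + t) \<le> f s + f t"
proof -
  have "f (s + t) / (s + t) < f s / s" "f (s + t) / (s + t) < f t / t"
    using st by (auto intro!: monotone_onD[OF f])
  then have "s * (f (s + t) / (s + t)) \<le> f s" "t * (f (s + t) / (s + t)) \<le> f t"
    using st by (simp_all add: field_simps)
  then have "(s + t) * (f (s + t) / (s + t)) \<le> f s + f t"
    by (simp only: distrib_right)
  then show ?thesis
    using st by simp
qed

text \<open>A convex function that stays bounded on the right cannot increase: in the three-point
  inequality for \<open>s < t < w\<close>, sending \<open>w\<close> to infinity leaves \<open>h t \<le> h s\<close>. Strict convexity at the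
  midpoint then makes the decrease strict.\<close>

lemma strictly_convex_with_limit_imp_strict_antimono:
  fixes h :: "real \<Rightarrow> real"
  assumes h: "strictly_convex_on {a..} h" and lim: "(h \<longlongrightarrow> l) at_top"
  shows "strict_antimono_on {a..} h"
proof -
  have conv: "(w - s) * h t < (w - t) * h s + (t - s) * h w" if "a \<le> s" "s < t" "t < w" for s t w
  proof -
    \<comment> \<open>\<open>t\<close> as a convex combination of \<open>s\<close> and \<open>w\<close>.\<close>
    define u v where "u = (w - t) / (w - s)" and "v = (t - s) / (w - s)"
    have "u > 0" "v > 0" "u + v = 1"
      using that by (auto simp: u_def v_def add_divide_distrib[symmetric])
    moreover have "u * s + v * w = t"
      using that by (simp add: u_def v_def divide_simps) (simp add: algebra_simps)
    ultimately have "h t < u * h s + v * h w"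
      using strictly_convex_onD[OF h, of s w u v] that by simp
    also have "\<dots> = ((w - t) * h s + (t - s) * h w) / (w - s)"
      by (simp add: u_def v_def add_divide_distrib)
    finally show ?thesis
      using that by (simp add: pos_less_divide_eq mult.commute)
  qed
  have le: "h t \<le> h s" if "a \<le> s" "s < t" for s t
  proof -
    \<comment> \<open>The three-point inequality divided by \<open>w\<close>, in the limit \<open>w \<rightarrow> \<infinity>\<close>.\<close>
    have "((\<lambda>w. (1 - s / w) * h t) \<longlongrightarrow> (1 - 0) * h t) at_top"
      by (intro tendsto_intros) real_asymp
    moreover have "((\<lambda>w. (1 - t / w) * h s + ((t - s) / w) * h w) \<longlongrightarrow> (1 - 0) * h s + 0 * l) at_top"
      by (intro tendsto_intros lim) real_asymp+
    moreover have "eventually (\<lambda>w. (1 - s / w) * h t \<le> (1 - t / w) * h s + ((t - s) / w) * h w) at_top"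
      using eventually_gt_at_top[of "max 0 t"]
    proof eventually_elim
      case (elim w)
      then have "((w - s) * h t) / w \<le> ((w - t) * h s + (t - s) * h w) / w"
        using conv[OF that, of w] by (intro divide_right_mono) auto
      then show ?case
        using elim by (simp add: add_divide_distrib diff_divide_distrib left_diff_distrib)
    qed
    ultimately have "(1 - 0) * h t \<le> (1 - 0) * h s + 0 * l"
      by (intro tendsto_le[of at_top]) auto
    then show ?thesis
      by simp
  qed
  show ?thesis
  proof (rule monotone_onI)
    fix s t assume st: "s \<in> {a..}" "t \<in> {a..}" "s < t"
    define m where "m = (s + t) / 2"
    have m: "s < m" "m < t"
      using st by (auto simp: m_def)
    have "(t - s) * h m < (t - m) * h s + (m - s) * h t"
      using conv[of s m t] m st by simp
    also have "\<dots> \<le> (t - m) * h s + (m - s) * h s"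
      using le[of s t] st m by simp
    also have "\<dots> = (t - s) * h s"
      by (simp add: algebra_simps)
    finally have "h m < h s"
      using st by simp
    then show "h t < h s"
      using le[of m t] m st by simp
  qed
qed

lemma reflect_deriv:
  fixes f :: "real \<Rightarrow> real"
  assumes "(f has_real_derivative D) (at (1 - x))"
  shows "((\<lambda>x. f (1 - x)) has_real_derivative - D) (at x)"
proof -
  have "((\<lambda>x. 1 - x) has_real_derivative - 1) (at x)"
    by (auto intro!: derivative_eq_intros)
  from DERIV_chain2[of f D "\<lambda>x. 1 - x", OF assms this] show ?thesis
    by simp
qed

text \<open>Keeping the factor \<open>x powr c\<close> in the derivative, rather than \<open>x powr (c - 1)\<close>, leaves identities
  that are rational in \<open>x\<close> and in the single atom \<open>x powr c\<close>.\<close>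

lemma powr_deriv:
  fixes x c :: real
  assumes "x > 0"
  shows "((\<lambda>x. x powr c) has_real_derivative c * x powr c / x) (at x)"
  using assms by (auto intro!: derivative_eq_intros simp: powr_diff)

lemma powser_deriv_sums:
  fixes c :: "nat \<Rightarrow> real" and x :: real
  assumes c: "\<And>z. \<bar>z\<bar> < 1 \<Longrightarrow> summable (\<lambda>n. c n * z ^ n)" and x: "\<bar>x\<bar> < 1"
  obtains D where "((\<lambda>z. \<Sum>n. c n * z ^ n) has_real_derivative D) (at x)"
    "(\<lambda>n. (real n + 1) * c (Suc n) * x ^ n) sums D" "(\<lambda>n. real n * c n * x ^ n) sums (x * D)"
proof
  let ?D = "\<Sum>n. diffs c n * x ^ n"
  show "((\<lambda>z. \<Sum>n. c n * z ^ n) has_real_derivative ?D) (at x)"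
    using c x by (intro termdiffs_strong'[of 1]) auto
  obtain K where K: "\<bar>x\<bar> < K" "K < 1"
    using x dense by blast
  have "summable (\<lambda>n. diffs c n * x ^ n)"
    using K c by (intro termdiff_converges[of x 1]) auto
  then have s: "(\<lambda>n. diffs c n * x ^ n) sums ?D"
    by (rule summable_sums)
  then show "(\<lambda>n. (real n + 1) * c (Suc n) * x ^ n) sums ?D"
    by (simp add: diffs_def add.commute)
  have "(\<lambda>n. real (Suc n) * c (Suc n) * x ^ Suc n) sums (x * ?D)"
    using sums_mult[OF s, of x] by (simp add: diffs_def algebra_simps)
  then show "(\<lambda>n. real n * c n * x ^ n) sums (x * ?D)"
    by (subst (asm) sums_Suc_iff) simp
qed

lemma one_minus_times_ln_deriv:
  fixes k c x :: real
  assumes "x < 1"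
  shows "((\<lambda>x. k * ((1 - x) * (c - ln (1 - x)))) has_real_derivative - (k * (c - 1 - ln (1 - x)))) (at x)"
proof -
  have "((\<lambda>x. k * ((1 - x) * (c - ln (1 - x)))) has_real_derivative
      k * ((1 - x) * (1 / (1 - x)) + (- 1) * (c - ln (1 - x)))) (at x)"
    using assms by (auto intro!: derivative_eq_intros)
  also have "k * ((1 - x) * (1 / (1 - x)) + (- 1) * (c - ln (1 - x))) = - (k * (c - 1 - ln (1 - x)))"
    using assms by (simp add: algebra_simps)
  finally show ?thesis .
qed

section \<open>The zero-balanced hypergeometric series as a first-order system\<close>

definition zb_coeff :: "real \<Rightarrow> real \<Rightarrow> nat \<Rightarrow> real" where
  "zb_coeff a b n = pochhammer a n * pochhammer b n / (pochhammer (a + b) n * fact n)"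

definition zb_F :: "real \<Rightarrow> real \<Rightarrow> real \<Rightarrow> real" where
  "zb_F a b x = (\<Sum>n. zb_coeff a b n * x ^ n)"

text \<open>Coefficients of \<open>P(x) = (1 - x) F'(x)\<close>. They are \<open>(n + 1) f\<^bsub>n+1\<^esub> - n f\<^sub>n\<close>, that is
  \<open>((a + n) (b + n) - n (c + n)) f\<^sub>n / (c + n)\<close>, whose bracket is just \<open>a b\<close> because the third
  parameter \<open>c\<close> is \<open>a + b\<close>. In contrast to \<open>F'\<close>, the function
  \<open>P\<close> extends continuously to \<open>x = 1\<close>.\<close>

definition zb_P_coeff :: "real \<Rightarrow> real \<Rightarrow> nat \<Rightarrow> real" where
  "zb_P_coeff a b n = a * b / (a + b + real n) * zb_coeff a b n"

definition zb_P :: "real \<Rightarrow> real \<Rightarrow> real \<Rightarrow> real" where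
  "zb_P a b x = (\<Sum>n. zb_P_coeff a b n * x ^ n)"

lemma hypergeo_F_eq_zb_F: "hypergeo_F a b (a + b) = zb_F a b"
  unfolding hypergeo_F_def zb_F_def zb_coeff_def by (simp add: field_simps)

lemma zb_F_commute: "zb_F a b = zb_F b a"
  unfolding zb_F_def zb_coeff_def by (simp add: fun_eq_iff algebra_simps)

locale zero_balanced =
  fixes a b :: real
  assumes a_pos: "a > 0" and b_pos: "b > 0"
begin

abbreviation f where "f \<equiv> zb_coeff a b"
abbreviation p where "p \<equiv> zb_P_coeff a b"
abbreviation F where "F \<equiv> zb_F a b"
abbreviation P where "P \<equiv> zb_P a b"

lemma coeff_pos: "f n > 0"
  using a_pos b_pos by (simp add: zb_coeff_def pochhammer_pos)

lemma coeff_Suc: "(real n + 1) * f (Suc n) = (a + n) * (b + n) / (a + b + n) * f n"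
proof -
  have "pochhammer (a + b) n > 0" "a + b + n > 0"
    using a_pos b_pos by (auto intro: pochhammer_pos)
  then show ?thesis
    by (simp add: zb_coeff_def pochhammer_Suc divide_simps)
qed

lemma P_coeff_pos: "p n > 0"
  using a_pos b_pos coeff_pos by (simp add: zb_P_coeff_def add_pos_nonneg)

lemma P_coeff_telescopes: "p n = (real n + 1) * f (Suc n) - real n * f n"
proof -
  have "a + b + n > 0"
    using a_pos b_pos by auto
  then show ?thesis
    unfolding coeff_Suc zb_P_coeff_def by (simp add: divide_simps) (simp add: algebra_simps)
qed

text \<open>The product \<open>n f\<^sub>n\<close> is a quotient of the Gauss products for \<open>\<Gamma>\<close>,
  in which the powers of \<open>n\<close> cancel because the series is zero-balanced.\<close>

lemma coeff_asymptotics: "(\<lambda>n. real n * f n) \<longlonglongrightarrow> 1 / Beta a b"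
proof -
  \<comment> \<open>\<open>Gamma_series z m\<close> has \<open>pochhammer z (m + 1)\<close> in its denominator, hence the shift by one.\<close>
  have eq: "Gamma_series (a + b) m / (Gamma_series a m * Gamma_series b m) = real (Suc m) * f (Suc m)" for m
    using pochhammer_pos[OF a_pos, of "Suc m"] pochhammer_pos[OF b_pos, of "Suc m"]
      pochhammer_pos[of "a + b" "Suc m"] a_pos b_pos
    by (simp add: Gamma_series_def zb_coeff_def distrib_right exp_add divide_simps del: of_nat_Suc)
  have "(\<lambda>m. Gamma_series (a + b) m / (Gamma_series a m * Gamma_series b m))
      \<longlonglongrightarrow> Gamma (a + b) / (Gamma a * Gamma b)"
    using Gamma_real_pos[OF a_pos] Gamma_real_pos[OF b_pos] by (intro tendsto_intros) auto
  then have "(\<lambda>m. real (Suc m) * f (Suc m)) \<longlonglongrightarrow> 1 / Beta a b"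
    by (simp only: eq) (simp add: Beta_def)
  then show ?thesis
    by (rule LIMSEQ_imp_Suc)
qed

lemma Beta_pos: "Beta a b > 0"
  using a_pos b_pos by (simp add: Beta_def Gamma_real_pos)

text \<open>The coefficients telescope, so their sum is the limit of \<open>n f\<^sub>n\<close>.\<close>

lemma P_coeff_sums: "p sums (1 / Beta a b)"
proof -
  have "(\<lambda>n. real (Suc n) * f (Suc n) - real n * f n) sums (1 / Beta a b - real 0 * f 0)"
    by (rule telescope_sums[OF coeff_asymptotics])
  then show ?thesis
    unfolding P_coeff_telescopes by (simp add: add.commute)
qed

lemma summable_F:
  assumes "\<bar>x\<bar> < 1"
  shows "summable (\<lambda>n. f n * x ^ n)"
proof -
  have "Bseq (\<lambda>n. real n * f n)"
    using coeff_asymptotics by (intro convergent_imp_Bseq convergentI)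
  then obtain K where K: "\<And>n. norm (real n * f n) \<le> K"
    unfolding Bseq_def by auto
  have "summable (\<lambda>n. K * \<bar>x\<bar> ^ n)"
    using assms by (intro summable_mult summable_geometric) simp
  moreover have "norm (f n * x ^ n) \<le> K * \<bar>x\<bar> ^ n" if "n \<ge> 1" for n
  proof -
    have "f n \<le> real n * f n"
      using that coeff_pos[of n] mult_right_mono[of 1 "real n" "f n"] by auto
    also have "\<dots> \<le> K"
      using K[of n] by simp
    finally show ?thesis
      using coeff_pos[of n] by (simp add: abs_mult power_abs mult_right_mono)
  qed
  ultimately show ?thesis
    by (rule summable_comparison_test')
qed

lemma summable_P:
  assumes "\<bar>x\<bar> \<le> 1"
  shows "summable (\<lambda>n. p n * x ^ n)"
proof (rule summable_comparison_test')
  show "summable p"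
    using P_coeff_sums by (rule sums_summable)
  show "norm (p n * x ^ n) \<le> p n" if "n \<ge> 0" for n
    using P_coeff_pos[of n] assms mult_left_mono[OF power_le_one[of "\<bar>x\<bar>" n], of "p n"]
    by (simp add: abs_mult power_abs)
qed

text \<open>Together with the formula for \<open>P'\<close> below, this is the hypergeometric equation written as a
  first-order system. All later differentiations use only these two rules.\<close>

lemma F_deriv:
  assumes x: "\<bar>x\<bar> < 1"
  shows "(F has_real_derivative P x / (1 - x)) (at x)"
proof -
  obtain D where D: "((\<lambda>z. \<Sum>n. f n * z ^ n) has_real_derivative D) (at x)"
    "(\<lambda>n. (real n + 1) * f (Suc n) * x ^ n) sums D" "(\<lambda>n. real n * f n * x ^ n) sums (x * D)"
    using powser_deriv_sums[OF summable_F x] by blast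
  have "(\<lambda>n. p n * x ^ n) sums (D - x * D)"
    using sums_diff[OF D(2,3)] unfolding P_coeff_telescopes by (simp add: algebra_simps)
  then have "P x = (1 - x) * D"
    unfolding zb_P_def by (simp add: sums_iff algebra_simps)
  with D(1) x show ?thesis
    by (simp add: zb_F_def[abs_def])
qed

text \<open>Coefficientwise this is \<open>(n + a + b) p\<^sub>n = a b f\<^sub>n\<close>.\<close>

lemma P_deriv:
  assumes x: "\<bar>x\<bar> < 1" "x \<noteq> 0"
  shows "(P has_real_derivative (a * b * F x - (a + b) * P x) / x) (at x)"
proof -
  have sm: "summable (\<lambda>n. p n * z ^ n)" if "\<bar>z\<bar> < 1" for z
    using summable_P that by simp
  obtain D where D: "((\<lambda>z. \<Sum>n. p n * z ^ n) has_real_derivative D) (at x)"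
    "(\<lambda>n. (real n + 1) * p (Suc n) * x ^ n) sums D" "(\<lambda>n. real n * p n * x ^ n) sums (x * D)"
    by (rule powser_deriv_sums[OF sm x(1)])
  have "(\<lambda>n. p n * x ^ n) sums P x"
    unfolding zb_P_def using sm x by (intro summable_sums) auto
  from sums_add[OF D(3) sums_mult[OF this, of "a + b"]]
  have s: "(\<lambda>n. real n * p n * x ^ n + (a + b) * (p n * x ^ n)) sums (x * D + (a + b) * P x)" .
  have eq: "real n * p n * x ^ n + (a + b) * (p n * x ^ n) = a * b * (f n * x ^ n)" for n
  proof -
    have "a + b + n > 0"
      using a_pos b_pos by auto
    then have "(a + b + n) * p n = a * b * f n"
      by (simp add: zb_P_coeff_def)
    then show ?thesis
      by (metis (no_types, lifting) add.commute distrib_right mult.assoc)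
  qed
  have "(\<lambda>n. a * b * (f n * x ^ n)) sums (a * b * F x)"
    unfolding zb_F_def using summable_F x by (intro sums_mult summable_sums) auto
  with s have "x * D + (a + b) * P x = a * b * F x"
    unfolding eq by (rule sums_unique2)
  then have "D = (a * b * F x - (a + b) * P x) / x"
    using x by (simp add: field_simps)
  with D(1) show ?thesis
    by (simp add: zb_P_def[abs_def])
qed

lemma P_continuous: "continuous_on {-1..1} P"
proof (rule uniform_limit_theorem)
  show "uniform_limit {-1..1} (\<lambda>n x. \<Sum>i<n. p i * x ^ i) P sequentially"
    unfolding zb_P_def
  proof (rule Weierstrass_m_test)
    show "norm (p n * x ^ n) \<le> p n" if "x \<in> {-1..1}" for n x
      using P_coeff_pos[of n] that mult_left_mono[OF power_le_one[of "\<bar>x\<bar>" n], of "p n"]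
      by (auto simp: abs_mult power_abs abs_le_iff)
    show "summable p"
      using P_coeff_sums by (rule sums_summable)
  qed
qed (auto intro!: always_eventually continuous_intros)

lemma F_continuous: "continuous_on {-1<..<1} F"
  by (auto intro!: continuous_at_imp_continuous_on DERIV_isCont[OF F_deriv])

lemma F_0: "F 0 = 1"
  using powser_zero[of f] by (simp add: zb_F_def zb_coeff_def)

lemma P_0: "P 0 = a * b / (a + b)"
  using powser_zero[of p] by (simp add: zb_P_def zb_P_coeff_def zb_coeff_def)

lemma P_1: "P 1 = 1 / Beta a b"
  using P_coeff_sums by (simp add: zb_P_def sums_iff)

lemma P_pos: "0 \<le> x \<Longrightarrow> x \<le> 1 \<Longrightarrow> P x > 0"
  unfolding zb_P_def using P_coeff_pos summable_P[of x]
  by (intro suminf_pos2[of _ 0]) (auto intro!: mult_nonneg_nonneg simp: less_imp_le)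

lemma P_le: "0 \<le> x \<Longrightarrow> x \<le> 1 \<Longrightarrow> P x \<le> 1 / Beta a b"
  unfolding P_1[symmetric] zb_P_def
  by (intro suminf_le summable_P mult_left_mono less_imp_le[OF P_coeff_pos]) (auto simp: power_le_one)

lemma F_strict_mono:
  assumes "0 \<le> x" "x < y" "y < 1"
  shows "F x < F y"
proof (rule DERIV_pos_imp_increasing[OF \<open>x < y\<close>])
  fix z assume "x \<le> z" "z \<le> y"
  then show "\<exists>D. (F has_real_derivative D) (at z) \<and> D > 0"
    using F_deriv[of z] P_pos[of z] assms by (intro exI[of _ "P z / (1 - z)"]) auto
qed

lemma F_ge_1: "0 \<le> x \<Longrightarrow> x < 1 \<Longrightarrow> F x \<ge> 1"
  using F_strict_mono[of 0 x] F_0 by (cases "x = 0") auto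

lemma F_pos: "0 \<le> x \<Longrightarrow> x < 1 \<Longrightarrow> F x > 0"
  using F_ge_1[of x] by simp

section \<open>Concavity of the logarithmic derivative\<close>

text \<open>Write \<open>c = a + b\<close> and \<open>w = P / F = (1 - x) F' / F\<close>. The system gives the Riccati equation
  \<open>x w' = a b - c w - x w\<^sup>2 / (1 - x)\<close>, and differentiating it once more yields
  \<open>x w'' + (c + 1 + 2 x F' / F) w' = - w\<^sup>2 / (1 - x)\<^sup>2\<close>, which is linear in \<open>w'\<close> with integrating
  factor \<open>x\<^sup>c F\<^sup>2\<close>. The function defined here is \<open>x\<^sup>c\<^sup>+\<^sup>1 F\<^sup>2 w'\<close>, expressed through \<open>F\<close> and \<open>P\<close>; it is
  continuous at \<open>0\<close>, vanishes there and has a negative derivative.\<close>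

definition weighted_w_deriv where
  "weighted_w_deriv x = x powr (a + b) * ((a * b * F x - (a + b) * P x) * F x - x * (P x)\<^sup>2 / (1 - x))"

lemma P_over_F_deriv:
  assumes x: "0 < x" "x < 1"
  shows "((\<lambda>x. P x / F x) has_real_derivative weighted_w_deriv x / (x powr (a + b) * x * (F x)\<^sup>2)) (at x)"
proof -
  have [derivative_intros]: "(F has_real_derivative P x / (1 - x)) (at x)"
    "(P has_real_derivative (a * b * F x - (a + b) * P x) / x) (at x)"
    using F_deriv[of x] P_deriv[of x] x by auto
  have "F x > 0" "x powr (a + b) > 0"
    using F_pos x by auto
  then show ?thesis
    using x unfolding weighted_w_deriv_def
    by (auto intro!: derivative_eq_intros simp: divide_simps) (simp_all add: algebra_simps power2_eq_square)
qed

lemma weighted_w_deriv_deriv: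
  assumes x: "0 < x" "x < 1"
  shows "(weighted_w_deriv has_real_derivative - (x powr (a + b) * (P x)\<^sup>2 / (1 - x)\<^sup>2)) (at x)"
proof -
  have [derivative_intros]: "(F has_real_derivative P x / (1 - x)) (at x)"
    "(P has_real_derivative (a * b * F x - (a + b) * P x) / x) (at x)"
    "((\<lambda>x. x powr (a + b)) has_real_derivative (a + b) * x powr (a + b) / x) (at x)"
    using F_deriv[of x] P_deriv[of x] powr_deriv[of x] x by auto
  show ?thesis
    using x unfolding weighted_w_deriv_def[abs_def]
    by (auto intro!: derivative_eq_intros) (simp add: divide_simps, algebra)
qed

lemma powr_continuous: "continuous_on {0..<1} (\<lambda>x. x powr (a + b))"
  using a_pos b_pos by (intro continuous_on_powr' continuous_intros) auto

lemma weighted_w_deriv_continuous: "continuous_on {0..<1} weighted_w_deriv"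
  unfolding weighted_w_deriv_def[abs_def]
  by (intro powr_continuous continuous_intros continuous_on_subset[OF F_continuous] continuous_on_subset[OF P_continuous]) auto

lemma weighted_w_deriv_0: "weighted_w_deriv 0 = 0"
  using a_pos b_pos by (simp add: weighted_w_deriv_def)

lemma weighted_w_deriv_neg:
  assumes "0 < x" "x < 1"
  shows "weighted_w_deriv x < 0"
proof -
  have "weighted_w_deriv x < weighted_w_deriv 0"
  proof (rule DERIV_neg_imp_decreasing_open[OF \<open>0 < x\<close>])
    fix z assume z: "0 < z" "z < x"
    then have "P z > 0"
      using assms by (intro P_pos) auto
    then have "z powr (a + b) * (P z)\<^sup>2 / (1 - z)\<^sup>2 > 0"
      using z assms by simp
    then show "\<exists>D. (weighted_w_deriv has_real_derivative D) (at z) \<and> D < 0"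
      using weighted_w_deriv_deriv[of z] z assms by (intro exI[of _ "- (z powr (a + b) * (P z)\<^sup>2 / (1 - z)\<^sup>2)"]) auto
  next
    show "continuous_on {0..x} weighted_w_deriv"
      using assms by (intro continuous_on_subset[OF weighted_w_deriv_continuous]) auto
  qed
  then show ?thesis
    by (simp add: weighted_w_deriv_0)
qed

lemma P_over_F_strict_antimono:
  assumes "0 < x" "x < y" "y < 1"
  shows "P y / F y < P x / F x"
proof (rule DERIV_neg_imp_decreasing[OF \<open>x < y\<close>])
  fix z assume z: "x \<le> z" "z \<le> y"
  then have "weighted_w_deriv z / (z powr (a + b) * z * (F z)\<^sup>2) < 0"
    using weighted_w_deriv_neg[of z] F_pos[of z] assms by (auto intro!: divide_neg_pos)
  then show "\<exists>D. ((\<lambda>x. P x / F x) has_real_derivative D) (at z) \<and> D < 0"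
    using P_over_F_deriv[of z] z assms by (intro exI[of _ "weighted_w_deriv z / (z powr (a + b) * z * (F z)\<^sup>2)"]) auto
qed

text \<open>This is \<open>x (1 - x)\<close> times the logarithmic derivative of \<open>F\<close>. Since \<open>x (1 - x)\<close> is also
  \<open>dx/dt\<close> for the logistic \<open>x\<close>, this is the derivative of \<open>ln F\<close> along \<open>x = e\<^sup>t / (1 + e\<^sup>t)\<close>.\<close>

definition G where
  "G x = x * P x / F x"

definition G' where
  "G' x = a * b + (1 - (a + b)) * (P x / F x) - x * (P x)\<^sup>2 / ((1 - x) * (F x)\<^sup>2)"

lemma G_deriv:
  assumes x: "0 < x" "x < 1"
  shows "(G has_real_derivative G' x) (at x)"
proof -
  have [derivative_intros]: "(F has_real_derivative P x / (1 - x)) (at x)"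
    "(P has_real_derivative (a * b * F x - (a + b) * P x) / x) (at x)"
    using F_deriv[of x] P_deriv[of x] x by auto
  have "F x > 0"
    using F_pos x by auto
  then show ?thesis
    using x unfolding G_def[abs_def] G'_def
    by (auto intro!: derivative_eq_intros) (simp add: divide_simps, algebra)
qed

text \<open>This is \<open>x\<^sup>c\<^sup>+\<^sup>1 F\<^sup>2 G''\<close>. The second derivative of \<open>G = x w\<close> obeys a first-order linear
  equation with the same integrating factor as \<open>w'\<close>, namely
  \<open>x G''' + (c + 1 + 2 x F' / F) G'' = - 2 S\<^sup>2 / (1 - x)\<close> with \<open>S = w / (1 - x) + x w'\<close>.
  That the right-hand side is minus a perfect square is what makes \<open>G\<close> concave for all positive
  \<open>a\<close> and \<open>b\<close>; \<open>G\<close> itself is not monotone.\<close>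

definition weighted_G_deriv2 where
  "weighted_G_deriv2 x = (1 - (a + b) - 2 * x * P x / ((1 - x) * F x)) * weighted_w_deriv x
     - x powr (a + b) * x * (P x)\<^sup>2 / (1 - x)\<^sup>2"

lemma G'_deriv:
  assumes x: "0 < x" "x < 1"
  shows "(G' has_real_derivative weighted_G_deriv2 x / (x powr (a + b) * x * (F x)\<^sup>2)) (at x)"
proof -
  define w where "w x = P x / F x" for x
  define w' where "w' = weighted_w_deriv x / (x powr (a + b) * x * (F x)\<^sup>2)"
  have pos: "F x > 0" "x powr (a + b) > 0"
    using F_pos x by auto
  have eq: "G' = (\<lambda>x. a * b + (1 - (a + b)) * w x - x / (1 - x) * (w x)\<^sup>2)"
    by (simp add: fun_eq_iff G'_def w_def power_divide)
  have [derivative_intros]: "(w has_real_derivative w') (at x)"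
    unfolding w_def[abs_def] w'_def by (rule P_over_F_deriv[OF x])
  have "(G' has_real_derivative
      (1 - (a + b) - 2 * x * w x / (1 - x)) * w' - (w x)\<^sup>2 / (1 - x)\<^sup>2) (at x)"
    using x unfolding eq by (auto intro!: derivative_eq_intros) (simp add: divide_simps, algebra)
  moreover have "(1 - (a + b) - 2 * x * w x / (1 - x)) * w' - (w x)\<^sup>2 / (1 - x)\<^sup>2
      = weighted_G_deriv2 x / (x powr (a + b) * x * (F x)\<^sup>2)"
    using x pos unfolding weighted_G_deriv2_def w_def w'_def by (simp add: divide_simps)
  ultimately show ?thesis
    by simp
qed

lemma weighted_G_deriv2_deriv:
  assumes x: "0 < x" "x < 1"
  shows "(weighted_G_deriv2 has_real_derivative
     - (2 * x powr (a + b) / (1 - x) * (P x * F x / (1 - x) + weighted_w_deriv x / x powr (a + b))\<^sup>2 / (F x)\<^sup>2)) (at x)"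
proof -
  note [derivative_intros] = weighted_w_deriv_deriv[OF x]
  have [derivative_intros]: "(F has_real_derivative P x / (1 - x)) (at x)"
    "(P has_real_derivative (a * b * F x - (a + b) * P x) / x) (at x)"
    "((\<lambda>x. x powr (a + b)) has_real_derivative (a + b) * x powr (a + b) / x) (at x)"
    using F_deriv[of x] P_deriv[of x] powr_deriv[of x] x by auto
  have pos: "F x > 0" "x powr (a + b) > 0"
    using F_pos x by auto
  show ?thesis
    using x pos unfolding weighted_G_deriv2_def[abs_def]
    by (auto intro!: derivative_eq_intros) (simp add: divide_simps, simp add: weighted_w_deriv_def divide_simps, algebra)
qed

lemma weighted_G_deriv2_continuous: "continuous_on {0..<1} weighted_G_deriv2"
  unfolding weighted_G_deriv2_def[abs_def]
  by (intro powr_continuous continuous_intros weighted_w_deriv_continuous continuous_on_subset[OF F_continuous] continuous_on_subset[OF P_continuous])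
     (use F_pos in \<open>force+\<close>)

lemma weighted_G_deriv2_0: "weighted_G_deriv2 0 = 0"
  using a_pos b_pos by (simp add: weighted_G_deriv2_def weighted_w_deriv_0)

lemma weighted_G_deriv2_antimono:
  assumes "0 \<le> x" "x \<le> y" "y < 1"
  shows "weighted_G_deriv2 y \<le> weighted_G_deriv2 x"
proof (rule DERIV_nonpos_imp_decreasing_open[OF \<open>x \<le> y\<close>])
  fix z assume z: "x < z" "z < y"
  then show "\<exists>D. (weighted_G_deriv2 has_real_derivative D) (at z) \<and> D \<le> 0"
    using weighted_G_deriv2_deriv[of z] assms
    by (intro exI[of _ "- (2 * z powr (a + b) / (1 - z) * (P z * F z / (1 - z) + weighted_w_deriv z / z powr (a + b))\<^sup>2 / (F z)\<^sup>2)"])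
       auto
next
  show "continuous_on {x..y} weighted_G_deriv2"
    using assms by (intro continuous_on_subset[OF weighted_G_deriv2_continuous]) auto
qed

text \<open>The derivative of the weighted function is only known to be nonpositive. It is negative near
  \<open>0\<close>, where the squared term tends to \<open>a b / (a + b) > 0\<close>, and this makes the inequality strict
  on the whole interval.\<close>

lemma weighted_G_deriv2_neg:
  assumes x: "0 < x" "x < 1"
  shows "weighted_G_deriv2 x < 0"
proof -
  \<comment> \<open>The squared term without division by \<open>z powr (a + b)\<close>, so that it is continuous at \<open>0\<close>.\<close>
  define S where "S z = P z * F z / (1 - z) + ((a * b * F z - (a + b) * P z) * F z - z * (P z)\<^sup>2 / (1 - z))" for z
  have S_eq: "S z = P z * F z / (1 - z) + weighted_w_deriv z / z powr (a + b)" if "0 < z" "z < 1" for z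
    using that by (simp add: S_def weighted_w_deriv_def)
  have "continuous_on {0..1/2} S"
    unfolding S_def[abs_def]
    by (intro continuous_intros continuous_on_subset[OF F_continuous] continuous_on_subset[OF P_continuous]) auto
  then have "(S \<longlongrightarrow> S 0) (at_right 0)"
    by (rule continuous_on_Icc_at_rightD[where b = "1 / 2"]) simp
  moreover have "S 0 > 0"
    using a_pos b_pos by (simp add: S_def F_0 P_0)
  ultimately have "eventually (\<lambda>z. S z > 0) (at_right 0)"
    by (rule order_tendstoD(1))
  then obtain e where e: "e > 0" "\<And>z. 0 < z \<Longrightarrow> z < e \<Longrightarrow> S z > 0"
    unfolding eventually_at_right_field by auto
  define y where "y = min (e / 2) x"
  have y: "0 < y" "y < e" "y \<le> x"
    using e x by (auto simp: y_def)
  have "weighted_G_deriv2 y < weighted_G_deriv2 0"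
  proof (rule DERIV_neg_imp_decreasing_open[OF \<open>0 < y\<close>])
    fix z assume z: "0 < z" "z < y"
    then have "2 * z powr (a + b) / (1 - z) * (S z)\<^sup>2 / (F z)\<^sup>2 > 0"
      using x y e(2)[of z] F_pos[of z] by simp
    then show "\<exists>D. (weighted_G_deriv2 has_real_derivative D) (at z) \<and> D < 0"
      using weighted_G_deriv2_deriv[of z] S_eq[of z] x y z
      by (intro exI[of _ "- (2 * z powr (a + b) / (1 - z) * (S z)\<^sup>2 / (F z)\<^sup>2)"]) auto
  next
    show "continuous_on {0..y} weighted_G_deriv2"
      using x y by (intro continuous_on_subset[OF weighted_G_deriv2_continuous]) auto
  qed
  moreover have "weighted_G_deriv2 x \<le> weighted_G_deriv2 y"
    using x y by (intro weighted_G_deriv2_antimono) auto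
  ultimately show ?thesis
    by (simp add: weighted_G_deriv2_0)
qed

lemma G'_strict_antimono:
  assumes "0 < x" "x < y" "y < 1"
  shows "G' y < G' x"
proof (rule DERIV_neg_imp_decreasing[OF \<open>x < y\<close>])
  fix z assume z: "x \<le> z" "z \<le> y"
  then have "weighted_G_deriv2 z / (z powr (a + b) * z * (F z)\<^sup>2) < 0"
    using weighted_G_deriv2_neg[of z] F_pos[of z] assms by (auto intro!: divide_neg_pos)
  then show "\<exists>D. (G' has_real_derivative D) (at z) \<and> D < 0"
    using G'_deriv[of z] z assms by (intro exI[of _ "weighted_G_deriv2 z / (z powr (a + b) * z * (F z)\<^sup>2)"]) auto
qed

section \<open>Logarithmic behaviour at 1\<close>

text \<open>Integrate \<open>F' = P / (1 - x)\<close> with \<open>P \<le> P(1) = 1 / B\<close>.\<close>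

lemma F_le:
  assumes "0 \<le> x" "x < 1"
  shows "F x \<le> 1 - ln (1 - x) / Beta a b"
proof -
  have "F x + ln (1 - x) / Beta a b \<le> F 0 + ln (1 - 0) / Beta a b"
  proof (rule DERIV_nonpos_imp_nonincreasing[OF \<open>0 \<le> x\<close>])
    fix z assume z: "0 \<le> z" "z \<le> x"
    have "(P z - 1 / Beta a b) / (1 - z) \<le> 0"
      using z assms P_le[of z] by (intro divide_nonpos_nonneg) auto
    moreover have "((\<lambda>x. F x + ln (1 - x) / Beta a b) has_real_derivative (P z - 1 / Beta a b) / (1 - z)) (at z)"
      using z assms F_deriv[of z] Beta_pos by (auto intro!: derivative_eq_intros simp: diff_divide_distrib)
    ultimately show "\<exists>D. ((\<lambda>x. F x + ln (1 - x) / Beta a b) has_real_derivative D) (at z) \<and> D \<le> 0"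
      by blast
  qed
  then show ?thesis
    by (simp add: F_0)
qed

text \<open>From \<open>x P' = a b F - c P\<close> and the logarithmic bound on \<open>F\<close>, this constant times
  \<open>1 - ln (1 - x)\<close> bounds \<open>P'\<close> on \<open>[1/2, 1)\<close>.\<close>

definition gap_const where
  "gap_const = 2 * a * b * (1 + 1 / Beta a b)"

lemma gap_const_nonneg: "gap_const \<ge> 0"
  using a_pos b_pos Beta_pos by (simp add: gap_const_def)

text \<open>Integrate the bound on \<open>P'\<close> from \<open>x\<close> to \<open>1\<close>. The term added to \<open>P\<close> in the proof is an
  antiderivative of minus that bound.\<close>

lemma P_gap:
  assumes x: "1/2 \<le> x" "x < 1"
  shows "1 / Beta a b - P x \<le> gap_const * ((1 - x) * (2 - ln (1 - x)))"
proof -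
  define g where "g x = P x + gap_const * ((1 - x) * (2 - ln (1 - x)))" for x
  have "g y \<le> g x" if y: "x \<le> y" "y < 1" for y
  proof (rule DERIV_nonpos_imp_nonincreasing[OF \<open>x \<le> y\<close>])
    fix z assume z: "x \<le> z" "z \<le> y"
    define D where "D = (a * b * F z - (a + b) * P z) / z"
    have z01: "1/2 \<le> z" "z < 1" and ln: "ln (1 - z) \<le> 0"
      using x y z by auto
    have "D \<le> a * b * F z / z"
      unfolding D_def using z01 P_pos[of z] a_pos b_pos by (intro divide_right_mono) auto
    also have "\<dots> \<le> a * b * F z / (1/2)"
      using z01 F_pos[of z] a_pos b_pos by (intro divide_left_mono) auto
    also have "\<dots> \<le> 2 * a * b * (1 - ln (1 - z) / Beta a b)"
      using F_le[of z] z01 a_pos b_pos by simp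
    also have "\<dots> \<le> 2 * a * b * ((1 + 1 / Beta a b) * (1 - ln (1 - z)))"
    proof (rule mult_left_mono)
      have "ln (1 - z) \<le> 1 / Beta a b"
        using ln Beta_pos by (intro order.trans[OF ln]) simp
      then show "1 - ln (1 - z) / Beta a b \<le> (1 + 1 / Beta a b) * (1 - ln (1 - z))"
        using ln by (simp add: algebra_simps)
    qed (use a_pos b_pos in simp)
    finally have "D - gap_const * (1 - ln (1 - z)) \<le> 0"
      by (simp add: gap_const_def algebra_simps add_divide_distrib diff_divide_distrib)
    moreover have "(g has_real_derivative D + - (gap_const * (2 - 1 - ln (1 - z)))) (at z)"
      unfolding g_def[abs_def] using z01 P_deriv[of z, folded D_def]
      by (intro DERIV_add one_minus_times_ln_deriv) auto
    then have "(g has_real_derivative D - gap_const * (1 - ln (1 - z))) (at z)"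
      by simp
    ultimately show "\<exists>D. (g has_real_derivative D) (at z) \<and> D \<le> 0"
      by blast
  qed
  then have "eventually (\<lambda>y. g y \<le> g x) (at_left 1)"
    using x(2) unfolding eventually_at_left_field by auto
  moreover have "(P \<longlongrightarrow> P 1) (at_left 1)"
    by (rule continuous_on_Icc_at_leftD[OF P_continuous]) simp
  then have "(g \<longlongrightarrow> P 1 + gap_const * 0) (at_left 1)"
    unfolding g_def[abs_def] by (intro tendsto_intros) (simp, real_asymp)
  ultimately have "P 1 + gap_const * 0 \<le> g x"
    by (intro tendsto_upperbound) auto
  then show ?thesis
    by (simp add: g_def P_1)
qed

text \<open>The derivative of \<open>L = F + ln (1 - x) / B\<close> is \<open>(P - 1 / B) / (1 - x)\<close>, hence nonpositive and
  bounded below by a multiple of \<open>- (2 - ln (1 - x))\<close>. So \<open>L\<close> decreases while \<open>L - e\<close> increases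
  for an \<open>e\<close> that tends to \<open>0\<close>, which traps a limit between them with explicit error.\<close>

lemma F_asymptotics:
  obtains l where "\<And>x. 1/2 \<le> x \<Longrightarrow> x < 1 \<Longrightarrow> l \<le> F x + ln (1 - x) / Beta a b"
    "\<And>x. 1/2 \<le> x \<Longrightarrow> x < 1 \<Longrightarrow>
       F x + ln (1 - x) / Beta a b \<le> l + gap_const * ((1 - x) * (3 - ln (1 - x)))"
proof -
  define L where "L x = F x + ln (1 - x) / Beta a b" for x
  define e where "e x = gap_const * ((1 - x) * (3 - ln (1 - x)))" for x
  have L_deriv: "(L has_real_derivative (P x - 1 / Beta a b) / (1 - x)) (at x)"
    if "1/2 \<le> x" "x < 1" for x
    unfolding L_def[abs_def] using that F_deriv[of x] Beta_pos
    by (auto intro!: derivative_eq_intros simp: diff_divide_distrib)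
  have e_deriv: "(e has_real_derivative - (gap_const * (2 - ln (1 - x)))) (at x)"
    if "x < 1" for x
    unfolding e_def[abs_def] using one_minus_times_ln_deriv[OF that, of gap_const 3] by simp
  have L_antimono: "L y \<le> L x" if "1/2 \<le> x" "x \<le> y" "y < 1" for x y
  proof (rule DERIV_nonpos_imp_nonincreasing[OF \<open>x \<le> y\<close>])
    fix z assume z: "x \<le> z" "z \<le> y"
    have "(P z - 1 / Beta a b) / (1 - z) \<le> 0"
      using z that P_le[of z] by (intro divide_nonpos_nonneg) auto
    then show "\<exists>D. (L has_real_derivative D) (at z) \<and> D \<le> 0"
      using L_deriv[of z] z that by (auto intro: exI[of _ "(P z - 1 / Beta a b) / (1 - z)"])
  qed
  have Le_mono: "L x - e x \<le> L y - e y" if "1/2 \<le> x" "x \<le> y" "y < 1" for x y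
  proof (rule DERIV_nonneg_imp_nondecreasing[OF \<open>x \<le> y\<close>])
    fix z assume z: "x \<le> z" "z \<le> y"
    define D where "D = (P z - 1 / Beta a b) / (1 - z) - (- (gap_const * (2 - ln (1 - z))))"
    have "D \<ge> 0"
      using P_gap[of z] z that by (simp add: D_def field_simps)
    moreover have "((\<lambda>x. L x - e x) has_real_derivative D) (at z)"
      unfolding D_def using z that by (intro DERIV_diff L_deriv e_deriv) auto
    ultimately show "\<exists>D. ((\<lambda>x. L x - e x) has_real_derivative D) (at z) \<and> D \<ge> 0"
      by blast
  qed
  have e_nonneg: "e x \<ge> 0" if "1/2 \<le> x" "x < 1" for x
  proof -
    have "ln (1 - x) \<le> 0"
      using that by simp
    then show ?thesis
      unfolding e_def using that gap_const_nonneg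
      by (intro mult_nonneg_nonneg) (auto simp del: ln_le_zero_iff)
  qed
  have lower: "L x - e x \<le> L y" if "1/2 \<le> x" "x < 1" "1/2 \<le> y" "y < 1" for x y
    using L_antimono[of y x] Le_mono[of x y] e_nonneg[of x] e_nonneg[of y] that
    by (cases "x \<le> y") auto
  define l where "l = (INF x\<in>{1/2..<1}. L x)"
  have bdd: "bdd_below (L ` {1/2..<1})"
    using lower[of "1/2"] by (intro bdd_belowI2[of _ "L (1/2) - e (1/2)"]) auto
  show ?thesis
  proof (rule that)
    fix x :: real assume x: "1/2 \<le> x" "x < 1"
    show "l \<le> F x + ln (1 - x) / Beta a b"
      unfolding l_def using cINF_lower[OF bdd, of x] x by (simp add: L_def)
    have "L x - e x \<le> l"
      unfolding l_def using lower[OF x] by (intro cINF_greatest) auto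
    then show "F x + ln (1 - x) / Beta a b \<le> l + gap_const * ((1 - x) * (3 - ln (1 - x)))"
      by (simp add: L_def e_def)
  qed
qed

end

section \<open>The constant term as a digamma expression\<close>

text \<open>The asymptotic formula for \<open>F\<close> reads \<open>B F(x) = - ln (1 - x) + R + o(1)\<close>, with \<open>B\<close> the beta
  function. Its constant term is treated as a function of both parameters, because it is
  identified below by moving them.\<close>

definition zb_const_term :: "real \<Rightarrow> real \<Rightarrow> real" where
  "zb_const_term a b = Lim (at_left 1) (\<lambda>x. Beta a b * zb_F a b x + ln (1 - x))"

context zero_balanced
begin

lemma F_bounds:
  assumes x: "1/2 \<le> x" "x < 1"
  shows "zb_const_term a b \<le> Beta a b * F x + ln (1 - x)"
    and "Beta a b * F x + ln (1 - x) \<le> zb_const_term a b + Beta a b * gap_const * ((1 - x) * (3 - ln (1 - x)))"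
    and "((\<lambda>x. Beta a b * F x + ln (1 - x)) \<longlongrightarrow> zb_const_term a b) (at_left 1)"
proof -
  obtain l where l: "\<And>x. 1/2 \<le> x \<Longrightarrow> x < 1 \<Longrightarrow> l \<le> F x + ln (1 - x) / Beta a b"
    "\<And>x. 1/2 \<le> x \<Longrightarrow> x < 1 \<Longrightarrow>
       F x + ln (1 - x) / Beta a b \<le> l + gap_const * ((1 - x) * (3 - ln (1 - x)))"
    using F_asymptotics by blast
  have eq: "Beta a b * F x + ln (1 - x) = Beta a b * (F x + ln (1 - x) / Beta a b)" for x
    using Beta_pos by (simp add: field_simps)
  have B: "Beta a b * l \<le> Beta a b * F x + ln (1 - x)"
    "Beta a b * F x + ln (1 - x) \<le> Beta a b * l + Beta a b * gap_const * ((1 - x) * (3 - ln (1 - x)))"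
    if "1/2 \<le> x" "x < 1" for x
    using mult_left_mono[OF l(1)[OF that], of "Beta a b"] mult_left_mono[OF l(2)[OF that], of "Beta a b"] Beta_pos
    unfolding eq by (auto simp: algebra_simps)
  have ev: "eventually (\<lambda>x. 1/2 \<le> x \<and> x < 1) (at_left (1::real))"
    by (auto simp: eventually_at_left_field intro!: exI[of _ "1/2"])
  have lim: "((\<lambda>x. Beta a b * F x + ln (1 - x)) \<longlongrightarrow> Beta a b * l) (at_left 1)"
  proof (rule tendsto_sandwich)
    show "eventually (\<lambda>x. Beta a b * l \<le> Beta a b * F x + ln (1 - x)) (at_left 1)"
      using ev by eventually_elim (use B in auto)
    show "eventually (\<lambda>x. Beta a b * F x + ln (1 - x)
        \<le> Beta a b * l + Beta a b * gap_const * ((1 - x) * (3 - ln (1 - x)))) (at_left 1)"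
      using ev by eventually_elim (use B in auto)
    have "((\<lambda>x::real. (1 - x) * (3 - ln (1 - x))) \<longlongrightarrow> 0) (at_left 1)"
      by real_asymp
    then have "((\<lambda>x. Beta a b * l + Beta a b * gap_const * ((1 - x) * (3 - ln (1 - x))))
        \<longlongrightarrow> Beta a b * l + Beta a b * gap_const * 0) (at_left 1)"
      by (intro tendsto_intros)
    then show "((\<lambda>x. Beta a b * l + Beta a b * gap_const * ((1 - x) * (3 - ln (1 - x))))
        \<longlongrightarrow> Beta a b * l) (at_left 1)"
      by simp
  qed simp
  then have const_term: "zb_const_term a b = Beta a b * l"
    unfolding zb_const_term_def by (intro tendsto_Lim) simp_all
  show "zb_const_term a b \<le> Beta a b * F x + ln (1 - x)"
    and "Beta a b * F x + ln (1 - x) \<le> zb_const_term a b + Beta a b * gap_const * ((1 - x) * (3 - ln (1 - x)))"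
    and "((\<lambda>x. Beta a b * F x + ln (1 - x)) \<longlongrightarrow> zb_const_term a b) (at_left 1)"
    using B[OF x] lim unfolding const_term by auto
qed

lemma const_term_tendsto: "((\<lambda>x. Beta a b * F x + ln (1 - x)) \<longlongrightarrow> zb_const_term a b) (at_left 1)"
  by (rule F_bounds(3)[of "1/2"]) simp_all

text \<open>Normalised by the beta function, the coefficients depend on \<open>a\<close> only through a single beta value.
  Monotonicity in \<open>a\<close> and the recurrence under \<open>a \<mapsto> a + 1\<close> are inherited from that value.\<close>

lemma Beta_times_coeff: "Beta a b * f n = Beta (a + n) b * pochhammer b n / fact n"
proof -
  have "z \<notin> \<int>\<^sub>\<le>\<^sub>0" if "z > 0" for z :: real
    using that by (auto elim!: nonpos_Ints_cases')
  then have "pochhammer a n = Gamma (a + n) / Gamma a"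
    "pochhammer (a + b) n = Gamma (a + n + b) / Gamma (a + b)"
    using a_pos b_pos pochhammer_Gamma[of a n] pochhammer_Gamma[of "a + b" n]
    by (simp_all add: add.assoc add.commute[of b])
  moreover have "Gamma a > 0" "Gamma (a + b) > 0" "Gamma (a + n + b) > 0"
    using a_pos b_pos by (auto intro!: Gamma_real_pos)
  ultimately show ?thesis
    by (simp add: Beta_def zb_coeff_def)
qed

end

lemma const_term_antimono:
  assumes "0 < a" "a \<le> a'" "0 < b"
  shows "zb_const_term a' b \<le> zb_const_term a b"
proof -
  interpret A: zero_balanced a b using assms by unfold_locales
  interpret A': zero_balanced a' b using assms by unfold_locales auto
  have le: "Beta a' b * zb_F a' b x \<le> Beta a b * zb_F a b x" if "0 \<le> x" "x < 1" for x
    unfolding zb_F_def using that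
  proof (subst (1 2) suminf_mult[symmetric], simp_all add: A.summable_F A'.summable_F)
    show "(\<Sum>n. Beta a' b * (A'.f n * x ^ n)) \<le> (\<Sum>n. Beta a b * (A.f n * x ^ n))"
    proof (rule suminf_le)
      fix n :: nat
      have "Beta (a' + n) b \<le> Beta (a + n) b"
        using assms by (intro Beta_real_mono) auto
      then have "Beta a' b * A'.f n \<le> Beta a b * A.f n"
        unfolding A.Beta_times_coeff A'.Beta_times_coeff
        using assms by (intro divide_right_mono mult_right_mono pochhammer_nonneg) auto
      then show "Beta a' b * (A'.f n * x ^ n) \<le> Beta a b * (A.f n * x ^ n)"
        using that by (simp add: mult_right_mono flip: mult.assoc)
    qed (use that in \<open>auto intro!: summable_mult A.summable_F A'.summable_F\<close>)
  qed
  show ?thesis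
  proof (rule tendsto_le[OF _ A.const_term_tendsto A'.const_term_tendsto])
    show "eventually (\<lambda>x. Beta a' b * A'.F x + ln (1 - x) \<le> Beta a b * A.F x + ln (1 - x)) (at_left 1)"
      using le by (auto simp: eventually_at_left_field intro!: exI[of _ 0])
  qed simp
qed

text \<open>The difference of the two normalised series is \<open>(B / a) P(x)\<close>, which tends to
  \<open>(B / a) (1 / B) = 1 / a\<close>.\<close>

lemma const_term_plus1:
  assumes "0 < a" "0 < b"
  shows "zb_const_term (a + 1) b = zb_const_term a b - 1 / a"
proof -
  interpret A: zero_balanced a b using assms by unfold_locales
  interpret A': zero_balanced "a + 1" b using assms by unfold_locales auto
  have coeff: "Beta a b * A.f n - Beta (a + 1) b * A'.f n = Beta a b / a * A.p n" for n
  proof -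
    have "a + n \<notin> \<int>\<^sub>\<le>\<^sub>0"
      using assms by (auto elim!: nonpos_Ints_cases')
    from Beta_plus1_left[OF this, of b]
    have "(a + b + n) * Beta (a + 1 + n) b = (a + n) * Beta (a + n) b"
      by (simp add: add_ac)
    moreover have "a + b + n > 0"
      using assms by simp
    ultimately have step: "Beta (a + n) b - Beta (a + 1 + n) b = b / (a + b + n) * Beta (a + n) b"
      by (simp add: field_simps)
    have "Beta a b * A.f n - Beta (a + 1) b * A'.f n
        = (Beta (a + n) b - Beta (a + 1 + n) b) * (pochhammer b n / fact n)"
      unfolding A.Beta_times_coeff A'.Beta_times_coeff by (simp add: left_diff_distrib diff_divide_distrib)
    also have "\<dots> = b / (a + b + n) * (Beta a b * A.f n)"
      unfolding step A.Beta_times_coeff by simp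
    also have "\<dots> = Beta a b / a * A.p n"
      using assms by (simp add: zb_P_coeff_def)
    finally show ?thesis .
  qed
  have "Beta a b * A.F x - Beta (a + 1) b * A'.F x = Beta a b / a * A.P x" if "\<bar>x\<bar> < 1" for x
  proof -
    have "(\<lambda>n. Beta a b * (A.f n * x ^ n) - Beta (a + 1) b * (A'.f n * x ^ n))
        sums (Beta a b * A.F x - Beta (a + 1) b * A'.F x)"
      unfolding zb_F_def using that
      by (intro sums_diff sums_mult summable_sums A.summable_F A'.summable_F)
    moreover have "(\<lambda>n. Beta a b / a * (A.p n * x ^ n)) sums (Beta a b / a * A.P x)"
      unfolding zb_P_def using that by (intro sums_mult summable_sums A.summable_P) simp
    moreover have "Beta a b * (A.f n * x ^ n) - Beta (a + 1) b * (A'.f n * x ^ n)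
        = Beta a b / a * (A.p n * x ^ n)" for n
      using arg_cong[OF coeff[of n], of "\<lambda>y. y * x ^ n"] by (simp add: algebra_simps)
    ultimately show ?thesis
      by (metis (no_types, lifting) sums_cong sums_unique2)
  qed
  then have "eventually (\<lambda>x. Beta a b / a * A.P x
      = (Beta a b * A.F x + ln (1 - x)) - (Beta (a + 1) b * A'.F x + ln (1 - x))) (at_left 1)"
    by (auto simp: eventually_at_left_field intro!: exI[of _ 0])
  moreover have "((\<lambda>x. (Beta a b * A.F x + ln (1 - x)) - (Beta (a + 1) b * A'.F x + ln (1 - x)))
      \<longlongrightarrow> zb_const_term a b - zb_const_term (a + 1) b) (at_left 1)"
    by (intro tendsto_diff A.const_term_tendsto A'.const_term_tendsto)
  ultimately have "((\<lambda>x. Beta a b / a * A.P x) \<longlongrightarrow> zb_const_term a b - zb_const_term (a + 1) b) (at_left 1)"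
    by (simp add: tendsto_cong)
  moreover have "(A.P \<longlongrightarrow> A.P 1) (at_left 1)"
    by (rule continuous_on_Icc_at_leftD[OF A.P_continuous]) simp
  then have "((\<lambda>x. Beta a b / a * A.P x) \<longlongrightarrow> Beta a b / a * A.P 1) (at_left 1)"
    by (intro tendsto_intros)
  ultimately have "zb_const_term a b - zb_const_term (a + 1) b = Beta a b / a * A.P 1"
    by (rule tendsto_unique[rotated]) simp
  then show ?thesis
    using A.Beta_pos by (simp add: A.P_1)
qed

lemma const_term_commute: "zb_const_term a b = zb_const_term b a"
  unfolding zb_const_term_def by (simp only: zb_F_commute[of a b] Beta_commute[of a b])

text \<open>Here \<open>F(x) = - ln (1 - x) / x\<close> and the beta value is \<open>1\<close>.\<close>

lemma const_term_1_1: "zb_const_term 1 1 = 0"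
proof -
  interpret A: zero_balanced 1 1 by unfold_locales auto
  have coeff: "zb_coeff 1 1 n = 1 / (real n + 1)" for n
  proof -
    have "pochhammer 2 n = (1 + real n) * fact n"
      using pochhammer_rec[of "1::real" n] by (simp flip: pochhammer_fact)
    then show ?thesis
      by (simp add: zb_coeff_def divide_simps flip: pochhammer_fact)
  qed
  have F: "zb_F 1 1 x = - ln (1 - x) / x" if "0 < x" "x < 1" for x
  proof -
    have "ln (1 - x) = (\<Sum>n. (-1) ^ n * (1 / real (n + 1)) * ((1 - x) - 1) ^ Suc n)"
      using that by (intro ln_series) auto
    also have "\<dots> = (\<Sum>n. (- x) * (zb_coeff 1 1 n * x ^ n))"
    proof (intro arg_cong[of _ _ suminf] ext)
      fix n
      have "(- 1) ^ n * (- x) ^ n = x ^ n"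
        by (simp flip: power_mult_distrib)
      then show "(- 1) ^ n * (1 / real (n + 1)) * ((1 - x) - 1) ^ Suc n = (- x) * (zb_coeff 1 1 n * x ^ n)"
        by (simp add: coeff divide_simps) (simp add: algebra_simps)
    qed
    also have "\<dots> = (- x) * zb_F 1 1 x"
      unfolding zb_F_def using that by (intro suminf_mult A.summable_F) simp
    finally show ?thesis
      using that by (simp add: field_simps)
  qed
  have "Beta 1 1 = (1::real)"
    by (simp add: Beta_def Gamma_numeral)
  with F have "eventually (\<lambda>x. Beta 1 1 * zb_F 1 1 x + ln (1 - x) = - ln (1 - x) / x + ln (1 - x)) (at_left 1)"
    by (auto simp: eventually_at_left_field intro!: exI[of _ 0])
  moreover have "((\<lambda>x::real. - ln (1 - x) / x + ln (1 - x)) \<longlongrightarrow> 0) (at_left 1)"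
    by real_asymp
  ultimately have "((\<lambda>x. Beta 1 1 * zb_F 1 1 x + ln (1 - x)) \<longlongrightarrow> 0) (at_left 1)"
    by (simp only: tendsto_cong)
  then show ?thesis
    using A.const_term_tendsto by (intro tendsto_unique[of "at_left (1::real)"]) auto
qed

text \<open>The difference of two solutions of the same difference equation has period \<open>1\<close>. A decreasing
  solution varies by at most a finite sum of values of \<open>g\<close> over any bounded interval, which tends
  to \<open>0\<close> as the interval moves to infinity. A periodic difference of two such solutions is therefore
  constant.\<close>

lemma antimono_difference_equation_unique:
  fixes r s g :: "real \<Rightarrow> real"
  assumes r: "\<And>x y. 0 < x \<Longrightarrow> x \<le> y \<Longrightarrow> r y \<le> r x" "\<And>x. 0 < x \<Longrightarrow> r (x + 1) = r x - g x"
    and s: "\<And>x y. 0 < x \<Longrightarrow> x \<le> y \<Longrightarrow> s y \<le> s x" "\<And>x. 0 < x \<Longrightarrow> s (x + 1) = s x - g x"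
    and g: "(g \<longlongrightarrow> 0) at_top"
    and xy: "0 < x" "0 < y"
  shows "r x - s x = r y - s y"
proof -
  \<comment> \<open>Far out, a decreasing solution is asymptotically constant on bounded intervals.\<close>
  have flat: "(\<lambda>m. h (u + real m) - h (v + real m)) \<longlonglongrightarrow> 0"
    if h: "\<And>x y. 0 < x \<Longrightarrow> x \<le> y \<Longrightarrow> h y \<le> h x" "\<And>x. 0 < x \<Longrightarrow> h (x + 1) = h x - g x"
      and uv: "0 < u" "u \<le> v" for h u v
  proof -
    have step: "(\<lambda>m. h (u + real m) - h (u + real m + real k)) \<longlonglongrightarrow> 0" for k
    proof (induction k)
      case (Suc k)
      have "filterlim (\<lambda>m. u + real m + real k) at_top sequentially"
        by real_asymp
      then have "(\<lambda>m. g (u + real m + real k)) \<longlonglongrightarrow> 0"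
        by (rule filterlim_compose[OF g])
      from tendsto_add[OF Suc this]
      have "(\<lambda>m. h (u + real m) - (h (u + real m + real k) - g (u + real m + real k))) \<longlonglongrightarrow> 0"
        by (simp add: algebra_simps)
      moreover have "h (u + real m + real (Suc k)) = h (u + real m + real k) - g (u + real m + real k)" for m
        using h(2)[of "u + real m + real k"] uv by (simp add: add_ac)
      ultimately show ?case
        by simp
    qed simp
    obtain k :: nat where k: "v \<le> u + k"
      using real_arch_simple[of "v - u"] by (auto simp: algebra_simps)
    show ?thesis
    proof (rule tendsto_sandwich[OF _ _ tendsto_const step[of k]])
      show "eventually (\<lambda>m. 0 \<le> h (u + real m) - h (v + real m)) sequentially"
        using uv by (auto intro!: always_eventually h(1))
      show "eventually (\<lambda>m. h (u + real m) - h (v + real m) \<le> h (u + real m) - h (u + real m + real k)) sequentially"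
        using uv k by (auto intro!: always_eventually h(1))
    qed
  qed
  have main: "r x - s x = r y - s y" if xy: "0 < x" "x \<le> y" for x y
  proof -
    have periodic: "r (u + real m) - s (u + real m) = r u - s u" if "u > 0" for u m
    proof (induction m)
      case (Suc m)
      then show ?case
        using r(2)[of "u + real m"] s(2)[of "u + real m"] that by (simp add: add_ac)
    qed simp
    have "(\<lambda>m. (r (x + real m) - r (y + real m)) - (s (x + real m) - s (y + real m))) \<longlonglongrightarrow> 0 - 0"
      by (intro tendsto_diff flat r s xy)
    moreover have "(r (x + real m) - r (y + real m)) - (s (x + real m) - s (y + real m))
        = (r x - s x) - (r y - s y)" for m
      using periodic[of x m] periodic[of y m] xy by simp
    ultimately show ?thesis
      by (simp add: LIMSEQ_const_iff)
  qed
  show ?thesis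
    using main[of x y] main[of y x] xy by linarith
qed

text \<open>In the first parameter, the constant term and \<open>- \<Psi>\<close> are decreasing solutions of the same
  difference equation.\<close>

lemma const_term_plus_Digamma:
  assumes "0 < a" "0 < b"
  shows "zb_const_term a b + Digamma a = zb_const_term 1 b + Digamma 1"
proof -
  have "zb_const_term a b - (- Digamma a) = zb_const_term 1 b - (- Digamma 1)"
  proof (rule antimono_difference_equation_unique[where g = "\<lambda>x. 1 / x"])
    show "((\<lambda>x::real. 1 / x) \<longlongrightarrow> 0) at_top"
      by real_asymp
  qed (use assms in \<open>auto simp: const_term_plus1 Digamma_plus1 intro: const_term_antimono Digamma_real_mono\<close>)
  then show ?thesis
    by simp
qed

text \<open>Moving first \<open>a\<close> and then, by symmetry, \<open>b\<close> to \<open>1\<close> leaves \<open>2 \<Psi>(1) = - 2 \<gamma>\<close>.\<close>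

lemma const_term_eq_Ramanujan_R:
  assumes "0 < a" "0 < b"
  shows "zb_const_term a b = Ramanujan_R a b"
  using const_term_plus_Digamma[of a b] const_term_plus_Digamma[of b 1] assms const_term_1_1 const_term_commute[of 1 b]
  by (simp add: Ramanujan_R_def)

section \<open>The quotient on the real line\<close>

definition logistic :: "real \<Rightarrow> real" where
  "logistic t = exp t / (1 + exp t)"

lemma logistic_bounds: "0 < logistic t" "logistic t < 1"
  by (auto simp: logistic_def add_pos_pos)

lemma logistic_minus: "logistic (- t) = 1 - logistic t"
  and one_minus_logistic: "1 - logistic t = 1 / (1 + exp t)"
proof -
  have "exp t > 0"
    by simp
  then have "1 + exp t \<noteq> 0"
    by linarith
  then show "logistic (- t) = 1 - logistic t" "1 - logistic t = 1 / (1 + exp t)"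
    by (simp_all add: logistic_def exp_minus divide_simps)
qed

lemma logistic_deriv:
  "(logistic has_real_derivative logistic t * (1 - logistic t)) (at t)"
proof -
  have "exp t > 0"
    by simp
  then have "1 + exp t \<noteq> 0"
    by linarith
  then show ?thesis
    unfolding logistic_def[abs_def] by (auto intro!: derivative_eq_intros simp: divide_simps) (simp add: algebra_simps)
qed

lemma logistic_strict_mono: "s < t \<Longrightarrow> logistic s < logistic t"
  by (rule DERIV_pos_imp_increasing) (use logistic_deriv logistic_bounds in \<open>auto intro!: exI mult_pos_pos\<close>)

lemma logistic_0: "logistic 0 = 1 / 2"
  by (simp add: logistic_def)

context zero_balanced
begin

definition Q where "Q t = F (logistic t) / F (1 - logistic t)"

lemma F_logistic_pos: "F (logistic t) > 0" "F (1 - logistic t) > 0"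
  using logistic_bounds[of t] by (auto intro!: F_pos)

lemma Q_pos: "Q t > 0"
  using F_logistic_pos by (simp add: Q_def)

lemma Q_reflect: "Q t * Q (- t) = 1"
  using F_logistic_pos[of t] by (simp add: Q_def logistic_minus)

text \<open>The derivative of \<open>ln Q\<close> in terms of \<open>x = logistic t\<close>. It is symmetric under \<open>x \<mapsto> 1 - x\<close>, so
  concavity of \<open>G\<close> makes it decrease on \<open>[1/2, 1)\<close>.\<close>

definition slope where
  "slope x = G x + G (1 - x)"

lemma F_logistic_deriv:
  "((\<lambda>t. F (logistic t)) has_real_derivative logistic t * P (logistic t)) (at t)"
  "((\<lambda>t. F (1 - logistic t)) has_real_derivative - ((1 - logistic t) * P (1 - logistic t))) (at t)"
proof -
  have *: "((\<lambda>t. 1 - logistic t) has_real_derivative - (logistic t * (1 - logistic t))) (at t)"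
    using logistic_deriv[of t] by (auto intro!: derivative_eq_intros)
  show "((\<lambda>t. F (logistic t)) has_real_derivative logistic t * P (logistic t)) (at t)"
    using DERIV_chain2[OF F_deriv logistic_deriv, of t] logistic_bounds[of t] by (simp add: mult.commute)
  show "((\<lambda>t. F (1 - logistic t)) has_real_derivative - ((1 - logistic t) * P (1 - logistic t))) (at t)"
    using DERIV_chain2[OF F_deriv *] logistic_bounds[of t] by (simp add: mult.commute)
qed

lemma ln_Q_deriv: "((\<lambda>t. ln (Q t)) has_real_derivative slope (logistic t)) (at t)"
proof -
  have "((\<lambda>t. ln (F (logistic t)) - ln (F (1 - logistic t))) has_real_derivative slope (logistic t)) (at t)"
    using F_logistic_deriv[of t] F_logistic_pos[of t]
    by (auto intro!: derivative_eq_intros simp: slope_def G_def)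
  then show ?thesis
    using F_logistic_pos by (simp add: Q_def[abs_def] ln_divide_pos)
qed

text \<open>This is \<open>x (1 - x)\<close> times the Wronskian of \<open>F(1 - x)\<close> and \<open>F(x)\<close>. It is constant if
  \<open>a + b = 1\<close>, when both solve the same hypergeometric equation; in general its derivative
  is \<open>a + b - 1\<close> times \<open>P(1-x) F(x) - P(x) F(1-x)\<close>.\<close>

definition Q_deriv_numer where
  "Q_deriv_numer x = x * P x * F (1 - x) + (1 - x) * P (1 - x) * F x"

lemma Q_deriv: "(Q has_real_derivative Q_deriv_numer (logistic t) / (F (1 - logistic t))\<^sup>2) (at t)"
  using F_logistic_deriv[of t] F_logistic_pos[of t] unfolding Q_def[abs_def]
  by (auto intro!: derivative_eq_intros simp: Q_deriv_numer_def power2_eq_square)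

lemma slope_reflect: "slope (1 - x) = slope x"
  by (simp add: slope_def)

lemma slope_strict_antimono:
  assumes "1/2 \<le> x" "x < y" "y < 1"
  shows "slope y < slope x"
proof -
  have deriv: "(slope has_real_derivative G' z - G' (1 - z)) (at z)" if "0 < z" "z < 1" for z
    using DERIV_add[OF G_deriv[of z] reflect_deriv[OF G_deriv[of "1 - z"]]] that
    by (simp add: slope_def[abs_def])
  show ?thesis
  proof (rule DERIV_neg_imp_decreasing_open[OF \<open>x < y\<close>])
    fix z assume z: "x < z" "z < y"
    then show "\<exists>D. (slope has_real_derivative D) (at z) \<and> D < 0"
      using deriv[of z] G'_strict_antimono[of "1 - z" z] assms
      by (intro exI[of _ "G' z - G' (1 - z)"]) auto
  next
    show "continuous_on {x..y} slope"
      using assms by (intro continuous_at_imp_continuous_on ballI DERIV_isCont[OF deriv]) auto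
  qed
qed

text \<open>The sign of the derivative comes from \<open>P / F\<close> being decreasing, since \<open>1 - x \<le> x\<close>. This is the
  step where \<open>a + b \<ge> 1\<close> enters.\<close>

lemma Q_deriv_numer_mono:
  assumes c: "a + b \<ge> 1" and "1/2 \<le> x" "x \<le> y" "y < 1"
  shows "Q_deriv_numer x \<le> Q_deriv_numer y"
proof (rule DERIV_nonneg_imp_nondecreasing[OF \<open>x \<le> y\<close>])
  fix z assume z: "x \<le> z" "z \<le> y"
  then have z01: "1/2 \<le> z" "z < 1"
    using assms by auto
  have [derivative_intros]: "(F has_real_derivative P z / (1 - z)) (at z)"
    "(P has_real_derivative (a * b * F z - (a + b) * P z) / z) (at z)"
    "((\<lambda>x. F (1 - x)) has_real_derivative - (P (1 - z) / z)) (at z)"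
    "((\<lambda>x. P (1 - x)) has_real_derivative
       - ((a * b * F (1 - z) - (a + b) * P (1 - z)) / (1 - z))) (at z)"
    using F_deriv[of z] P_deriv[of z] reflect_deriv[OF F_deriv[of "1 - z"]]
      reflect_deriv[OF P_deriv[of "1 - z"]] z01 by auto
  have "(Q_deriv_numer has_real_derivative (a + b - 1) * (P (1 - z) * F z - P z * F (1 - z))) (at z)"
    using z01 unfolding Q_deriv_numer_def[abs_def]
    by (auto intro!: derivative_eq_intros) (simp add: algebra_simps)
  moreover have "P z / F z \<le> P (1 - z) / F (1 - z)"
  proof (cases "z = 1 / 2")
    case True
    then have "1 - z = z"
      by simp
    then show ?thesis
      by (simp only: order_refl)
  qed (use P_over_F_strict_antimono[of "1 - z" z] z01 in auto)
  then have "P (1 - z) * F z - P z * F (1 - z) \<ge> 0"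
    using F_pos[of z] F_pos[of "1 - z"] z01 by (simp add: field_simps)
  ultimately show "\<exists>D. (Q_deriv_numer has_real_derivative D) (at z) \<and> D \<ge> 0"
    using c by (auto intro!: exI mult_nonneg_nonneg)
qed

lemma Q_deriv_strict_mono:
  assumes "a + b \<ge> 1"
  shows "strict_mono_on {0..} (\<lambda>t. Q_deriv_numer (logistic t) / (F (1 - logistic t))\<^sup>2)"
proof (rule strict_mono_onI)
  fix s t :: real assume st: "s \<in> {0..}" "s < t"
  define x y where "x = logistic s" and "y = logistic t"
  have xy: "1/2 \<le> x" "x < y" "y < 1"
    using logistic_strict_mono[of s t] logistic_strict_mono[of 0 s] logistic_bounds[of t] st
    by (cases "s = 0"; auto simp: x_def y_def logistic_0)+
  have "F (1 - y) < F (1 - x)"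
    using xy by (intro F_strict_mono) auto
  then have sq: "(F (1 - y))\<^sup>2 < (F (1 - x))\<^sup>2"
    using F_pos[of "1 - y"] xy by (intro power_strict_mono) auto
  have numer_pos: "Q_deriv_numer x > 0"
    using xy P_pos[of x] P_pos[of "1 - x"] F_pos[of x] F_pos[of "1 - x"]
    unfolding Q_deriv_numer_def by (intro add_pos_pos mult_pos_pos) auto
  have "Q_deriv_numer x / (F (1 - x))\<^sup>2 < Q_deriv_numer x / (F (1 - y))\<^sup>2"
    using sq numer_pos F_pos[of "1 - x"] F_pos[of "1 - y"] xy by (intro divide_strict_left_mono) auto
  also have "\<dots> \<le> Q_deriv_numer y / (F (1 - y))\<^sup>2"
    using Q_deriv_numer_mono[OF assms, of x y] xy by (intro divide_right_mono) auto
  finally show "Q_deriv_numer (logistic s) / (F (1 - logistic s))\<^sup>2 < Q_deriv_numer (logistic t) / (F (1 - logistic t))\<^sup>2"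
    by (simp add: x_def y_def)
qed

lemma slope_logistic_strict_antimono: "strict_antimono_on {0..} (\<lambda>t. slope (logistic t))"
proof (rule monotone_onI)
  fix s t :: real assume st: "s \<in> {0..}" "s < t"
  have "1/2 \<le> logistic s"
    using logistic_strict_mono[of 0 s] st by (cases "s = 0") (auto simp: logistic_0)
  then show "slope (logistic t) < slope (logistic s)"
    using logistic_strict_mono[OF st(2)] logistic_bounds[of t] by (intro slope_strict_antimono)
qed

lemma slope_logistic_strict_mono: "strict_mono_on {..0} (\<lambda>t. slope (logistic t))"
proof (rule monotone_onI)
  fix s t :: real assume st: "s \<in> {..0}" "t \<in> {..0}" "s < t"
  then have "slope (logistic (- s)) < slope (logistic (- t))"
    by (intro monotone_onD[OF slope_logistic_strict_antimono]) auto
  then show "slope (logistic s) < slope (logistic t)"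
    by (simp add: logistic_minus slope_reflect)
qed

lemma Q_strict_mono: "strict_mono Q"
proof (rule strict_monoI)
  fix s t :: real assume "s < t"
  then have "logistic s < logistic t"
    by (rule logistic_strict_mono)
  then have "F (logistic s) < F (logistic t)" "F (1 - logistic t) < F (1 - logistic s)"
    using logistic_bounds[of s] logistic_bounds[of t] by (auto intro!: F_strict_mono)
  then show "Q s < Q t"
    unfolding Q_def using F_logistic_pos[of s] F_logistic_pos[of t]
    by (intro frac_less) auto
qed

text \<open>Put \<open>y = 1 - logistic t\<close>. Then \<open>y \<le> e\<^sup>-\<^sup>t\<close> and \<open>- ln y = t + O(e\<^sup>-\<^sup>t)\<close>. The numerator of
  \<open>B Q\<close> is \<open>R - ln y + O(y (3 - ln y))\<close> by the expansion at \<open>1\<close>, and the denominator is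
  \<open>1 + O(y)\<close>.\<close>

lemma Q_asymptotics:
  obtains C where
    "\<And>t. t \<ge> 1 \<Longrightarrow> \<bar>Q t - (t + Ramanujan_R a b) / Beta a b\<bar> \<le> C * (t * exp (- t))"
proof -
  define B where "B = Beta a b"
  define R where "R = Ramanujan_R a b"
  define C where "C = 1 + 5 * (B * gap_const) + 2 / B * (1 + \<bar>R\<bar>)"
  have B: "B > 0"
    using Beta_pos by (simp add: B_def)
  have K: "B * gap_const \<ge> 0"
    using B gap_const_nonneg by simp
  have main: "\<bar>B * Q t - (t + R)\<bar> \<le> C * (t * exp (- t))" if t: "t \<ge> 1" for t
  proof -
    define e where "e = exp (- t)"
    define y where "y = 1 - logistic t"
    define A where "A = B * F (logistic t)"
    define d where "d = F y - 1"
    have e: "0 < e"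
      by (simp add: e_def)
    have y_eq: "y = 1 / (1 + exp t)"
      by (simp add: y_def one_minus_logistic)
    have y: "0 < y" "y < 1"
      using logistic_bounds[of t] by (auto simp: y_def)
    have "logistic 0 < logistic t"
      using t by (intro logistic_strict_mono) simp
    then have y2: "y \<le> 1/2"
      by (simp add: y_def logistic_0)
    have ye: "y \<le> e"
      by (simp add: y_eq e_def exp_minus divide_simps add_pos_pos)
    have pos: "1 + exp t > 0"
      by (simp add: add_pos_pos)
    then have "- ln y = ln (1 + exp t)"
      unfolding y_eq by (subst ln_divide_pos) auto
    also have "1 + exp t = exp t * (1 + e)"
      by (simp add: e_def distrib_left flip: exp_add)
    also have "ln (exp t * (1 + e)) = ln (exp t) + ln (1 + e)"
      using e by (intro ln_mult_pos) auto
    finally have ln_y: "- ln y = t + ln (1 + e)"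
      by simp
    have ln_e: "0 \<le> ln (1 + e)" "ln (1 + e) \<le> e"
      using e ln_add_one_self_le_self[of e] by auto
    have e1: "e \<le> 1"
      using t by (simp add: e_def)
    have const_term: "zb_const_term a b = R"
      unfolding R_def by (rule const_term_eq_Ramanujan_R[OF a_pos b_pos])
    have "R \<le> A + ln y" "A + ln y \<le> R + B * gap_const * (y * (3 - ln y))"
      using F_bounds(1,2)[of "logistic t"] y y2 const_term by (auto simp: A_def B_def y_def)
    moreover have "0 \<le> 3 - ln y" "3 - ln y \<le> 5 * t"
      using ln_y ln_e e1 t by linarith+
    then have "y * (3 - ln y) \<le> e * (5 * t)"
      using ye e by (intro mult_mono) auto
    then have "B * gap_const * (y * (3 - ln y)) \<le> B * gap_const * (e * (5 * t))"
      using K by (rule mult_left_mono)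
    ultimately have A: "0 \<le> A - (t + R)" "A - (t + R) \<le> e + B * gap_const * (e * (5 * t))"
      using ln_y ln_e by linarith+
    have "F y \<ge> 1"
      using y by (intro F_ge_1) auto
    then have d: "d \<ge> 0"
      by (simp add: d_def)
    \<comment> \<open>The denominator: \<open>F y - 1\<close> is at most \<open>- ln (1 - y) / B\<close>, hence \<open>O(y)\<close>.\<close>
    have "- ln (1 - y) \<le> y + 2 * y\<^sup>2"
      using ln_one_minus_pos_lower_bound[of y] y y2 by simp
    also have "2 * y\<^sup>2 \<le> y"
      using y y2 by (simp add: power2_eq_square)
    finally have "- ln (1 - y) \<le> 2 * e"
      using ye by simp
    then have "- ln (1 - y) / B \<le> 2 * e / B"
      using B by (intro divide_right_mono) auto
    then have d_le: "d \<le> 2 / B * e"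
      using F_le[of y] y by (simp add: d_def B_def)
    have Q_eq: "B * Q t = A / (1 + d)"
      by (simp add: Q_def A_def d_def y_def)
    have "B * Q t - (t + R) = ((A - (t + R)) - d * (t + R)) / (1 + d)"
      using d by (simp add: Q_eq field_simps)
    also have "\<bar>\<dots>\<bar> \<le> \<bar>(A - (t + R)) - d * (t + R)\<bar> / 1"
      unfolding abs_divide using d by (intro divide_left_mono) auto
    also have "\<dots> \<le> (A - (t + R)) + d * \<bar>t + R\<bar>"
      using A d abs_triangle_ineq4[of "A - (t + R)" "d * (t + R)"] by (simp add: abs_mult)
    also have "\<dots> \<le> (e + B * gap_const * (e * (5 * t))) + (2 / B * e) * (t * (1 + \<bar>R\<bar>))"
    proof (rule add_mono[OF A(2)], rule mult_mono[OF d_le])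
      have "\<bar>t + R\<bar> \<le> t + \<bar>R\<bar>"
        using t by linarith
      also have "\<dots> \<le> t + t * \<bar>R\<bar>"
        using t mult_right_mono[of 1 t "\<bar>R\<bar>"] by simp
      finally show "\<bar>t + R\<bar> \<le> t * (1 + \<bar>R\<bar>)"
        by (simp add: distrib_left)
    qed (use B e in auto)
    also have "\<dots> \<le> C * (t * e)"
      using t e by (simp add: C_def algebra_simps)
    finally show ?thesis
      by (simp add: e_def)
  qed
  show ?thesis
  proof
    fix t :: real assume "t \<ge> 1"
    have "\<bar>Q t - (t + R) / B\<bar> = \<bar>B * Q t - (t + R)\<bar> / B"
      using B by (simp add: field_simps flip: abs_mult_pos)
    also have "\<dots> \<le> C * (t * exp (- t)) / B"
      using main[OF \<open>t \<ge> 1\<close>] B by (intro divide_right_mono) auto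
    finally show "\<bar>Q t - (t + Ramanujan_R a b) / Beta a b\<bar> \<le> C / B * (t * exp (- t))"
      by (simp add: R_def B_def)
  qed
qed

lemma Q_bigo:
  "(\<lambda>t. Q t - (t + Ramanujan_R a b) / Beta a b) \<in> O[at_top](\<lambda>t. t * exp (- t))"
proof -
  obtain C where C: "\<And>t. t \<ge> 1 \<Longrightarrow> \<bar>Q t - (t + Ramanujan_R a b) / Beta a b\<bar> \<le> C * (t * exp (- t))"
    using Q_asymptotics by blast
  show ?thesis
  proof (rule bigoI[of _ C])
    show "eventually (\<lambda>t. norm (Q t - (t + Ramanujan_R a b) / Beta a b) \<le> C * norm (t * exp (- t))) at_top"
      using eventually_ge_at_top[of 1] by eventually_elim (use C in simp)
  qed
qed

lemma Q_minus_linear_tendsto: "((\<lambda>t. Q t - t / Beta a b) \<longlongrightarrow> Ramanujan_R a b / Beta a b) at_top"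
proof -
  have "(\<lambda>t::real. t * exp (- t)) \<in> o[at_top](\<lambda>_. 1)"
    by real_asymp
  with Q_bigo have "(\<lambda>t. Q t - (t + Ramanujan_R a b) / Beta a b) \<in> o[at_top](\<lambda>_. 1)"
    by (rule landau_o.big_small_trans)
  then have "((\<lambda>t. Q t - (t + Ramanujan_R a b) / Beta a b) \<longlongrightarrow> 0) at_top"
    by (drule_tac smalloD_tendsto) simp
  then have "((\<lambda>t. (Q t - (t + Ramanujan_R a b) / Beta a b) + Ramanujan_R a b / Beta a b)
      \<longlongrightarrow> 0 + Ramanujan_R a b / Beta a b) at_top"
    by (intro tendsto_intros)
  then show ?thesis
    by (simp add: add_divide_distrib)
qed

text \<open>With \<open>Q = (t / B) (1 + z)\<close>, boundedness of \<open>Q - t / B\<close> gives \<open>z = O(1 / t)\<close>.\<close>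

lemma ln_Q_bigo: "(\<lambda>t. ln (Q t) - (ln t - ln (Beta a b))) \<in> O[at_top](\<lambda>t. 1 / t)"
proof -
  define B where "B = Beta a b"
  define R where "R = Ramanujan_R a b"
  define z where "z t = (Q t - t / B) * B / t" for t
  have B: "B > 0"
    using Beta_pos by (simp add: B_def)
  have "((\<lambda>t. (Q t - t / B) * B) \<longlongrightarrow> R / B * B) at_top"
    unfolding B_def R_def by (intro tendsto_intros Q_minus_linear_tendsto)
  then have "(\<lambda>t. (Q t - t / B) * B) \<in> O[at_top](\<lambda>_. 1)"
    by (intro bigoI_tendsto[where c = "R / B * B"]) auto
  from landau_o.big.mult[OF this landau_o.big_refl[of "\<lambda>t. 1 / t"]]
  have z: "z \<in> O[at_top](\<lambda>t. 1 / t)"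
    by (simp add: z_def[abs_def])
  have "(\<lambda>t::real. 1 / t) \<in> o[at_top](\<lambda>_. 1)"
    by real_asymp
  with z have "z \<in> o[at_top](\<lambda>_. 1)"
    by (rule landau_o.big_small_trans)
  then have z0: "(z \<longlongrightarrow> 0) at_top"
    by (drule_tac smalloD_tendsto) simp
  have "(\<lambda>t. ln (1 + z t)) \<in> O[at_top](z)"
  proof (rule bigoI[of _ 2])
    have "eventually (\<lambda>t. \<bar>z t\<bar> < 1/2) at_top"
      using tendstoD[OF z0, of "1/2"] by (simp add: dist_real_def)
    then show "eventually (\<lambda>t. norm (ln (1 + z t)) \<le> 2 * norm (z t)) at_top"
    proof eventually_elim
      case (elim t)
      have "\<bar>ln (1 + z t) - z t\<bar> \<le> 2 * (z t)\<^sup>2"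
        using abs_ln_one_plus_x_minus_x_bound[of "z t"] elim by simp
      also have "\<dots> \<le> \<bar>z t\<bar>"
        using elim mult_right_mono[of "2 * \<bar>z t\<bar>" 1 "\<bar>z t\<bar>"] by (simp add: power2_eq_square)
      finally show ?case
        by (simp add: abs_if split: if_splits)
    qed
  qed
  then have "(\<lambda>t. ln (1 + z t)) \<in> O[at_top](\<lambda>t. 1 / t)"
    using z by (rule landau_o.big_trans)
  moreover have "eventually (\<lambda>t. ln (1 + z t) = ln (Q t) - (ln t - ln B)) at_top"
    using eventually_gt_at_top[of 0]
  proof eventually_elim
    case (elim t)
    then have "1 + z t = Q t * B / t"
      using B by (simp add: z_def field_simps)
    then show ?case
      using elim B Q_pos[of t] by (simp add: ln_div ln_mult)
  qed
  ultimately show ?thesis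
    unfolding B_def by (subst (asm) landau_o.big.in_cong)
qed

text \<open>The difference is strictly convex because its derivative increases, and it has a finite limit
  at infinity; so it decreases.\<close>

lemma Q_minus_linear:
  assumes "a + b \<ge> 1"
  shows Q_minus_linear_convex: "strictly_convex_on {0..} (\<lambda>t. Q t - t / Beta a b)"
    and Q_minus_linear_antimono: "strict_antimono_on {0..} (\<lambda>t. Q t - t / Beta a b)"
proof -
  have deriv: "((\<lambda>t. Q t - t / Beta a b) has_real_derivative
      Q_deriv_numer (logistic t) / (F (1 - logistic t))\<^sup>2 - 1 / Beta a b) (at t)" for t
    by (intro DERIV_diff Q_deriv DERIV_cdivide DERIV_ident)
  show convex: "strictly_convex_on {0..} (\<lambda>t. Q t - t / Beta a b)"
    using Q_deriv_strict_mono[OF assms]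
    by (intro strictly_convex_on_if_deriv_strict_mono[OF _ deriv])
      (auto simp: is_interval_ci monotone_on_def)
  show "strict_antimono_on {0..} (\<lambda>t. Q t - t / Beta a b)"
    by (rule strictly_convex_with_limit_imp_strict_antimono[OF convex Q_minus_linear_tendsto])
qed

text \<open>The decreasing function \<open>Q - t / B\<close> lies strictly between its value \<open>1\<close> at \<open>0\<close> and its limit
  \<open>R / B\<close>.\<close>

lemma Q_bounds:
  assumes "a + b \<ge> 1" "t > 0"
  shows "(Ramanujan_R a b + t) / Beta a b < Q t" "Q t < 1 + t / Beta a b"
proof -
  note anti = Q_minus_linear_antimono[OF assms(1)]
  have "Q 0 = 1"
    using F_pos[of "1/2"] by (simp add: Q_def logistic_0)
  then show "Q t < 1 + t / Beta a b"
    using monotone_onD[OF anti, of 0 t] assms by simp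
  \<comment> \<open>The value at \<open>t + 1\<close> separates the value at \<open>t\<close> from the limit and keeps the inequality strict.\<close>
  have "eventually (\<lambda>u. Q u - u / Beta a b \<le> Q (t + 1) - (t + 1) / Beta a b) at_top"
    using eventually_gt_at_top[of "t + 1"]
    by eventually_elim (use monotone_onD[OF anti, of "t + 1"] assms in \<open>simp add: less_imp_le\<close>)
  then have "Ramanujan_R a b / Beta a b \<le> Q (t + 1) - (t + 1) / Beta a b"
    by (intro tendsto_upperbound[OF Q_minus_linear_tendsto]) auto
  also have "\<dots> < Q t - t / Beta a b"
    using monotone_onD[OF anti, of t "t + 1"] assms by simp
  finally show "(Ramanujan_R a b + t) / Beta a b < Q t"
    by (simp add: add_divide_distrib)
qed

end

theorem theorem3p8:
  fixes a b :: real and Q q :: "real \<Rightarrow> real"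
  assumes a_pos: "a > 0" and b_pos: "b > 0"
    and Q_def: "\<And>t. Q t = hypergeo_F a b (a + b) (exp t / (1 + exp t))
                         / hypergeo_F a b (a + b) (1 / (1 + exp t))"
    and q_def: "\<And>t. q t = ln (Q t)"
  shows
    "(strict_mono Q \<and> (\<forall>t. Q t > 0) \<and> (\<forall>t. Q t * Q (- t) = 1) \<and>
      (\<lambda>t. Q t - (t + Ramanujan_R a b) / Beta a b) \<in> O[at_top](\<lambda>t. t * exp (- t))) \<and>
     (strict_mono q \<and> (\<forall>t. q (- t) = - q t) \<and>
      (\<lambda>t. q t - (ln t - ln (Beta a b))) \<in> O[at_top](\<lambda>t. 1 / t)) \<and>
     ((\<forall>t. q differentiable (at t)) \<and>
      strict_mono_on {..0} (deriv q) \<and> strict_antimono_on {0..} (deriv q) \<and>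
      strictly_convex_on {..<0} q \<and> strictly_concave_on {0<..} q) \<and>
     (strict_antimono_on {0<..} (\<lambda>t. q t / t) \<and>
      (\<forall>t>0. \<forall>t'>0. q (t + t') \<le> q t + q t')) \<and>
     (a + b \<ge> 1 \<longrightarrow>
       strict_antimono_on {0<..} (\<lambda>t. Q t - t / Beta a b) \<and>
       strictly_convex_on {0<..} (\<lambda>t. Q t - t / Beta a b)) \<and>
     (a + b \<ge> 1 \<longrightarrow>
       (\<forall>t>0. (Ramanujan_R a b + t) / Beta a b < Q t \<and> Q t < 1 + t / Beta a b))"
proof -
  interpret Z: zero_balanced a b
    using a_pos b_pos by unfold_locales
  have Q: "Q = Z.Q"
    unfolding fun_eq_iff Q_def Z.Q_def hypergeo_F_eq_zb_F one_minus_logistic by (simp add: logistic_def)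
  have q: "q = (\<lambda>t. ln (Z.Q t))"
    by (simp add: fun_eq_iff q_def Q)
  have q_odd: "q (- t) = - q t" for t
    using Z.Q_reflect[of t] Z.Q_pos[of t] Z.Q_pos[of "- t"] unfolding q
    by (metis add_eq_0_iff ln_mult_pos ln_one)
  have q_deriv: "(q has_real_derivative Z.slope (logistic t)) (at t)" for t
    unfolding q by (rule Z.ln_Q_deriv)
  then have deriv_q: "deriv q = (\<lambda>t. Z.slope (logistic t))"
    by (auto intro!: DERIV_imp_deriv)
  have q_convex: "strictly_convex_on {..0} q"
    by (rule strictly_convex_on_if_deriv_strict_mono[OF _ q_deriv Z.slope_logistic_strict_mono])
      (simp add: is_interval_ic)
  have q_concave: "strictly_concave_on {0..} q"
    by (rule strictly_concave_on_if_deriv_strict_antimono[OF _ q_deriv Z.slope_logistic_strict_antimono])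
      (simp add: is_interval_ci)
  have ratio: "strict_antimono_on {0<..} (\<lambda>t. q t / t)"
    using q_odd[of 0] by (intro strictly_concave_imp_ratio_strict_antimono q_concave) simp
  have "strict_mono q"
    unfolding q using Z.Q_strict_mono Z.Q_pos by (auto simp: strict_mono_def)
  moreover have "\<forall>t. q differentiable (at t)"
    using q_deriv real_differentiable_def by blast
  moreover have "strictly_convex_on {..<0} q" "strictly_concave_on {0<..} q"
    by (auto intro: strictly_convex_on_subset[OF q_convex] strictly_concave_on_subset[OF q_concave])
  moreover have "strict_antimono_on {0<..} (\<lambda>t. Q t - t / Beta a b) \<and>
      strictly_convex_on {0<..} (\<lambda>t. Q t - t / Beta a b)" if "a + b \<ge> 1"
    unfolding Q using Z.Q_minus_linear[OF that]
    by (auto intro: monotone_on_subset strictly_convex_on_subset)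
  moreover have "(\<lambda>t. q t - (ln t - ln (Beta a b))) \<in> O[at_top](\<lambda>t. 1 / t)"
    unfolding q by (rule Z.ln_Q_bigo)
  ultimately show ?thesis
    using Z.Q_strict_mono Z.Q_pos Z.Q_reflect Z.Q_bigo Z.Q_bounds q_odd ratio
      ratio_antimono_imp_subadditive[OF ratio] Z.slope_logistic_strict_mono Z.slope_logistic_strict_antimono
    by (simp add: deriv_q Q)
qed

end
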